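(* There exist an integer $m\ge 2$, a vector field $\mathbf{B}=(\mathbf{B}^1,\mathbf{B}^2):\mathbb{R}^2\to\mathbb{R}^2$ and degree-zero homogeneous functions $\Omega^i_1,\dots,\Omega^i_m\in (L^\infty\cap BV)(S^1)$, $i=1,2$, with $\int_{S^1}\Omega^i_j=0$ for all $i,j$, such that $\frac{|\mathbf{B}(x)|}{|x|+1}\in L^1(\mathbb{R}^2)+L^\infty(\mathbb{R}^2)$, $\operatorname{div}(\mathbf{B})=0$, and: (a) for every $R>1$ there are bounded Radon measures $\mu^l_{jR}\in\mathcal{M}_b(\mathbb{R}^2)$ ($l=1,2$, $j=1,\dots,m$) with $$\partial_l\mathbf{B}^i=\sum_{j=1}^m\Big(\frac{\Omega^i_j(\cdot)}{|\cdot|^2}\Big)\star\mu^l_{jR}\quad\text{in }\mathcal{D}'(B_R),\qquad i,l=1,2;$$ (b) the problem $\frac{dX(t,x)}{dt}=\mathbf{B}(X(t,x))$ for $t\in[0,T]$, $X(0,x)=x$, is ill-posed: there exist two different regular Lagrangian flows $X_1,X_2$ associated to $\mathbf{B}$.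
   Context: $B_R$ is the open ball of radius $R$ centred at $0$. A function $\Omega$ is degree-zero homogeneous if $\Omega(sx)=\Omega(x)$ for all $s>0$. Convolution with $\Omega(\cdot)/|\cdot|^2$ is understood in the principal value sense. Regular Lagrangian flow (here $d=2$ and $\mathbf{B}$ is independent of $t$). A vector field $\mathbf{B}:(0,T)\times\mathbb{R}^d\to\mathbb{R}^d$ satisfies (R1) if $\frac{\mathbf{B}(t,x)}{1+|x|}=\tilde B_1(t,x)+\tilde B_2(t,x)$ with $\tilde B_1\in L^1((0,T);L^1(\mathbb{R}^d))$, $\tilde B_2\in L^1((0,T);L^\infty(\mathbb{R}^d))$. Let $L^0_{loc}$ be the space of measurable functions with local convergence in measure, $\log L_{loc}(\mathbb{R}^d)$ the space of measurable $u$ with $\int_{B_r}\log(1+|u|)dx<\infty$ for all $r>0$, and $\mathcal{B}(E_1;E_2)$ the space of bounded functions from $E_1$ to $E_2$. If $\mathbf{B}$ satisfies (R1), a regular Lagrangian flow associated to $\mathbf{B}$ starting at $t_0\in[0,T)$ (here $t_0=0$) is a map $X\in C([t_0,T];L^0_{loc}(\mathbb{R}^d))\cap\mathcal{B}([t_0,T];\log L_{loc}(\mathbb{R}^d))$ (with values in $\mathbb{R}^d$) such that: (i) $\partial_t(h(X(t,x)))=(\nabla h)(X(t,x))\,\mathbf{B}(t,X(t,x))$ in $\mathcal{D}'((t_0,T)\times\mathbb{R}^d)$ for every $h\in C^1(\mathbb{R}^d,\mathbb{R})$ with $|h(z)|\le C(1+\log(1+|z|))$ and $|\nabla h(z)|\le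 \frac{C}{1+|z|}$ for all $z$; (ii) $X(t_0,x)=x$ for a.e. $x$; (iii) there is a constant $L>0$ with $\int_{\mathbb{R}^d}\varphi(X(t,x))dx\le L\int_{\mathbb{R}^d}\varphi(x)dx$ for all measurable $\varphi:\mathbb{R}^d\to[0,\infty)$ and all $t\in[t_0,T]$. *)

theory Defs
  imports "HOL-Analysis.Analysis"
begin

section \<open>Test functions\<close>

text \<open>A function is \<open>C\<^sup>k\<^sup>+\<^sup>1\<close> iff it is differentiable with all partial derivatives \<open>C\<^sup>k\<close>.\<close>

fun Ck :: "nat \<Rightarrow> ('a::euclidean_space \<Rightarrow> real) \<Rightarrow> bool" where
  "Ck 0 f = continuous_on UNIV f"
| "Ck (Suc k) f = ((\<forall>x. f differentiable (at x)) \<and>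
     (\<forall>e\<in>Basis. Ck k (\<lambda>x. frechet_derivative f (at x) e)))"

definition test_function :: "'a::euclidean_space set \<Rightarrow> ('a \<Rightarrow> real) \<Rightarrow> bool" where
  "test_function U \<phi> \<longleftrightarrow> (\<forall>k. Ck k \<phi>) \<and>
     compact (closure {x. \<phi> x \<noteq> 0}) \<and> closure {x. \<phi> x \<noteq> 0} \<subseteq> U"

text \<open>The integrand below is \<open>B \<bullet> \<nabla>\<phi>\<close>.\<close>

definition weakly_div_free :: "('a::euclidean_space \<Rightarrow> 'a) \<Rightarrow> bool" where
  "weakly_div_free B \<longleftrightarrow>
     (\<forall>\<phi>. test_function UNIV \<phi> \<longrightarrow> (\<integral>x. frechet_derivative \<phi> (at x) (B x) \<partial>lebesgue) = 0)"


section \<open>Function spaces\<close>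

definition in_L1_plus_Linf :: "('a::euclidean_space \<Rightarrow> real) \<Rightarrow> bool" where
  "in_L1_plus_Linf f \<longleftrightarrow> (\<exists>g k. integrable lebesgue g \<and>
     k \<in> borel_measurable lebesgue \<and> (\<exists>C. AE x in lebesgue. \<bar>k x\<bar> \<le> C) \<and>
     (AE x in lebesgue. f x = g x + k x))"

definition zero_homogeneous :: "(real^2 \<Rightarrow> real) \<Rightarrow> bool" where
  "zero_homogeneous \<Omega> \<longleftrightarrow> (\<forall>s>0. \<forall>x. \<Omega> (s *\<^sub>R x) = \<Omega> x)"

text \<open>Functions on the unit circle are handled as \<open>2\<pi>\<close>-periodic functions of the angle (so that
  arc length is Lebesgue measure). A Borel representative is required, because \<open>\<Omega>\<close> is going to be
  integrated against arbitrary Borel measures.\<close>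

definition circle_pt :: "real \<Rightarrow> real^2" where
  "circle_pt \<theta> = vector [cos \<theta>, sin \<theta>]"

definition in_Linf_S1 :: "(real^2 \<Rightarrow> real) \<Rightarrow> bool" where
  "in_Linf_S1 \<Omega> \<longleftrightarrow> (\<lambda>\<theta>. \<Omega> (circle_pt \<theta>)) \<in> borel_measurable borel \<and>
     (\<exists>C. AE \<theta> in lebesgue. \<bar>\<Omega> (circle_pt \<theta>)\<bar> \<le> C)"

text \<open>BV in the distributional sense, i.e. the tangential derivative of \<open>\<Omega>\<close> is a finite measure
  on the circle: \<open>\<integral> \<Omega> \<psi>'\<close> is bounded over all \<open>C\<^sup>1\<close> functions \<open>\<psi>\<close> on the circle with
  \<open>\<bar>\<psi>\<bar> \<le> 1\<close>.\<close>

definition in_BV_S1 :: "(real^2 \<Rightarrow> real) \<Rightarrow> bool" where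
  "in_BV_S1 \<Omega> \<longleftrightarrow> set_integrable lebesgue {0..2*pi} (\<lambda>\<theta>. \<Omega> (circle_pt \<theta>)) \<and>
     (\<exists>C. \<forall>\<psi> \<psi>'. (\<forall>\<theta>. (\<psi> has_real_derivative \<psi>' \<theta>) (at \<theta>)) \<and> continuous_on UNIV \<psi>' \<and>
        (\<forall>\<theta>. \<psi> (\<theta> + 2*pi) = \<psi> \<theta>) \<and> (\<forall>\<theta>. \<bar>\<psi> \<theta>\<bar> \<le> 1) \<longrightarrow>
        set_lebesgue_integral lebesgue {0..2*pi} (\<lambda>\<theta>. \<Omega> (circle_pt \<theta>) * \<psi>' \<theta>) \<le> C)"

definition mean_zero_S1 :: "(real^2 \<Rightarrow> real) \<Rightarrow> bool" where
  "mean_zero_S1 \<Omega> \<longleftrightarrow> set_lebesgue_integral lebesgue {0..2*pi} (\<lambda>\<theta>. \<Omega> (circle_pt \<theta>)) = 0"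


section \<open>Bounded Radon measures and principal value convolution\<close>

text \<open>A bounded (signed) Radon measure is represented by a pair \<open>(\<mu>\<^sub>1, \<mu>\<^sub>2)\<close> of finite positive
  Borel measures, standing for \<open>\<mu>\<^sub>1 - \<mu>\<^sub>2\<close>. By the Jordan decomposition every bounded signed
  measure is of this form, and finite Borel measures on a Euclidean space are automatically
  Radon.\<close>

type_synonym 'a signed_measure = "'a measure \<times> 'a measure"

definition bounded_Radon :: "'a::euclidean_space signed_measure \<Rightarrow> bool" where
  "bounded_Radon \<mu> \<longleftrightarrow>
     finite_measure (fst \<mu>) \<and> sets (fst \<mu>) = sets borel \<and>
     finite_measure (snd \<mu>) \<and> sets (snd \<mu>) = sets borel"

definition signed_integral :: "'a signed_measure \<Rightarrow> ('a \<Rightarrow> real) \<Rightarrow> real" where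
  "signed_integral \<mu> f = (\<integral>y. f y \<partial>(fst \<mu>)) - (\<integral>y. f y \<partial>(snd \<mu>))"

definition truncated_conv ::
  "(real^2 \<Rightarrow> real) \<Rightarrow> (real^2) signed_measure \<Rightarrow> real \<Rightarrow> real^2 \<Rightarrow> real" where
  "truncated_conv \<Omega> \<mu> \<epsilon> x =
     signed_integral \<mu> (\<lambda>y. if norm (x - y) > \<epsilon> then \<Omega> (x - y) / (norm (x - y))\<^sup>2 else 0)"

text \<open>The value at \<open>\<phi>\<close> of the distribution \<open>(\<Omega>(\<cdot>)/\<bar>\<cdot>\<bar>\<^sup>2) \<star> \<mu>\<close> is \<open>c\<close>. Since \<open>\<mu>\<close> is only a measure,
  the pointwise principal value need not be locally integrable; the convolution is the limit of
  the truncated convolutions in the sense of distributions.\<close>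

definition has_pv_conv ::
  "(real^2 \<Rightarrow> real) \<Rightarrow> (real^2) signed_measure \<Rightarrow> (real^2 \<Rightarrow> real) \<Rightarrow> real \<Rightarrow> bool" where
  "has_pv_conv \<Omega> \<mu> \<phi> c \<longleftrightarrow>
     ((\<lambda>\<epsilon>. \<integral>x. truncated_conv \<Omega> \<mu> \<epsilon> x * \<phi> x \<partial>lebesgue) \<longlongrightarrow> c) (at_right 0)"

text \<open>\<open>\<partial>\<^sub>l f = \<Sum>\<^sub>j (\<Omega>\<^sub>j(\<cdot>)/\<bar>\<cdot>\<bar>\<^sup>2) \<star> \<mu>\<^sub>j\<close> (sum over \<open>j = 1, \<dots>, m\<close>) as distributions on \<open>U\<close>.\<close>

definition weak_partial_eq_pv_conv ::
  "(real^2) set \<Rightarrow> 2 \<Rightarrow> (real^2 \<Rightarrow> real) \<Rightarrow> nat \<Rightarrow> (nat \<Rightarrow> real^2 \<Rightarrow> real) \<Rightarrow>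
   (nat \<Rightarrow> (real^2) signed_measure) \<Rightarrow> bool" where
  "weak_partial_eq_pv_conv U l f m \<Omega> \<mu> \<longleftrightarrow>
     (\<forall>\<phi>. test_function U \<phi> \<longrightarrow>
        (\<exists>c. (\<forall>j\<in>{1..m}. has_pv_conv (\<Omega> j) (\<mu> j) \<phi> (c j)) \<and>
             - (\<integral>x. f x * frechet_derivative \<phi> (at x) (axis l 1) \<partial>lebesgue) = (\<Sum>j=1..m. c j)))"


section \<open>Regular Lagrangian flows\<close>

text \<open>A function belongs to \<open>L\<^sup>1((0,T);L\<^sup>\<infinity>)\<close> iff it is measurable in \<open>(t,x)\<close> and dominated by an
  integrable function of \<open>t\<close> alone.\<close>

definition R1 :: "real \<Rightarrow> (real \<Rightarrow> 'a::euclidean_space \<Rightarrow> 'a) \<Rightarrow> bool" where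
  "R1 T B \<longleftrightarrow> (\<exists>B1 B2 :: real \<times> 'a \<Rightarrow> 'a.
     integrable (lebesgue_on ({0<..<T} \<times> UNIV)) B1 \<and>
     B2 \<in> borel_measurable (lebesgue_on ({0<..<T} \<times> UNIV)) \<and>
     (\<exists>g. integrable (lebesgue_on {0<..<T}) g \<and>
        (AE z in lebesgue_on ({0<..<T} \<times> UNIV). norm (B2 z) \<le> g (fst z))) \<and>
     (AE z in lebesgue_on ({0<..<T} \<times> UNIV).
        (1 / (1 + norm (snd z))) *\<^sub>R B (fst z) (snd z) = B1 z + B2 z))"

definition continuous_L0_loc ::
  "real \<Rightarrow> real \<Rightarrow> (real \<Rightarrow> 'a::euclidean_space \<Rightarrow> 'a) \<Rightarrow> bool" where
  "continuous_L0_loc t0 T X \<longleftrightarrow>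
     (\<forall>t\<in>{t0..T}. X t \<in> borel_measurable lebesgue) \<and>
     (\<forall>t\<in>{t0..T}. \<forall>r>0. \<forall>\<epsilon>>0.
        ((\<lambda>s. measure lebesgue {x \<in> ball 0 r. norm (X s x - X t x) > \<epsilon>}) \<longlongrightarrow> 0)
          (at t within {t0..T}))"

definition bounded_logL_loc ::
  "real \<Rightarrow> real \<Rightarrow> (real \<Rightarrow> 'a::euclidean_space \<Rightarrow> 'a) \<Rightarrow> bool" where
  "bounded_logL_loc t0 T X \<longleftrightarrow>
     (\<forall>r>0. \<exists>C::real. \<forall>t\<in>{t0..T}.
        (\<integral>\<^sup>+x\<in>ball 0 r. ennreal (ln (1 + norm (X t x))) \<partial>lebesgue) \<le> ennreal C)"

text \<open>Joint measurability in \<open>(t,x)\<close> only selects a representative: every element of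
  \<open>C([t\<^sub>0,T];L\<^sup>0\<^sub>l\<^sub>o\<^sub>c)\<close> has a jointly measurable one, and the distributional equation is
  about such a representative.\<close>

definition regular_Lagrangian_flow ::
  "real \<Rightarrow> real \<Rightarrow> (real \<Rightarrow> 'a::euclidean_space \<Rightarrow> 'a) \<Rightarrow> (real \<Rightarrow> 'a \<Rightarrow> 'a) \<Rightarrow> bool" where
  "regular_Lagrangian_flow t0 T B X \<longleftrightarrow>
     0 \<le> t0 \<and> t0 < T \<and> R1 T B \<and>
     continuous_L0_loc t0 T X \<and> bounded_logL_loc t0 T X \<and>
     (\<lambda>z. X (fst z) (snd z)) \<in> borel_measurable (lebesgue_on ({t0..T} \<times> UNIV)) \<and>
     (\<forall>h Dh. (\<forall>z. GDERIV h z :> Dh z) \<and> continuous_on UNIV Dh \<and>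
        (\<exists>C. \<forall>z. \<bar>h z\<bar> \<le> C * (1 + ln (1 + norm z)) \<and> norm (Dh z) \<le> C / (1 + norm z)) \<longrightarrow>
        (\<forall>\<phi>. test_function ({t0<..<T} \<times> UNIV) \<phi> \<longrightarrow>
           - (\<integral>z. h (X (fst z) (snd z)) * frechet_derivative \<phi> (at z) (1, 0)
                \<partial>lebesgue_on ({t0<..<T} \<times> UNIV)) =
           (\<integral>z. (Dh (X (fst z) (snd z)) \<bullet> B (fst z) (X (fst z) (snd z))) * \<phi> z
                \<partial>lebesgue_on ({t0<..<T} \<times> UNIV)))) \<and>
     (AE x in lebesgue. X t0 x = x) \<and>
     (\<exists>L>0::real. \<forall>\<phi>::'a \<Rightarrow> real. \<phi> \<in> borel_measurable lebesgue \<and> (\<forall>x. 0 \<le> \<phi> x) \<longrightarrow>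
        (\<forall>t\<in>{t0..T}. (\<integral>\<^sup>+x. ennreal (\<phi> (X t x)) \<partial>lebesgue)
           \<le> ennreal L * (\<integral>\<^sup>+x. ennreal (\<phi> x) \<partial>lebesgue)))"

text \<open>Flows are identified when they agree almost everywhere at every time.\<close>

definition different_flows ::
  "real \<Rightarrow> real \<Rightarrow> (real \<Rightarrow> 'a::euclidean_space \<Rightarrow> 'a) \<Rightarrow> (real \<Rightarrow> 'a \<Rightarrow> 'a) \<Rightarrow> bool" where
  "different_flows t0 T X Y \<longleftrightarrow> (\<exists>t\<in>{t0..T}. \<not> (AE x in lebesgue. X t x = Y t x))"

end

theory Submission
  imports Defs
begin

text \<open>
  The field is \<open>B(x) = x\<^sub>1 x / \<bar>x\<bar>\<^sup>3\<close>. It is radial, even, homogeneous of degree \<open>-1\<close> and divergence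
  free: on the ray of angle \<open>\<theta>\<close> one has \<open>(r\<^sup>2/2)' = cos \<theta>\<close>. Trajectories starting in \<open>x\<^sub>1 < 0\<close> reach
  the origin in finite time and may leave it either along the same line or along the mirror image
  of the incoming ray; both continuations preserve area, which gives two flows.

  The derivatives of \<open>B\<close> are odd and homogeneous of degree \<open>-2\<close>, so their means on the circle vanish.
  As \<open>B\<close> is even, no Dirac mass appears at the origin, hence \<open>\<partial>\<^sub>l B\<^sup>i\<close> is the principal value
  distribution \<open>\<Omega>\<^sup>i\<^sub>l / \<bar>x\<bar>\<^sup>2\<close>, the convolution of \<open>\<Omega>\<^sup>i\<^sub>l / \<bar>\<cdot>\<bar>\<^sup>2\<close> with the Dirac measure at \<open>0\<close>.
\<close>

section \<open>Integration and test functions\<close>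

text \<open>In the coordinates r^2/2 and \<theta>, area is the product measure and the motion on
  each ray is a translation with speed cos \<theta>. Leaving the origin on another ray therefore
  preserves area as soon as the map of angles preserves d\<theta> and turns cos \<theta> into - cos
  \<theta>; both \<theta> + \<pi> and \<pi> - \<theta> do this. The obstacle is that the field blows
  up exactly where the two pieces of a trajectory are joined. Two facts control this. A trajectory
  meets the origin at most once, and an observable h(X) stays continuous there. Moreover 1/|X| is
  integrable, because the flow does not enlarge area and 1/|y| is locally integrable in the plane.
  The same integrability governs the derivatives: |x|^(-2) just fails to be integrable, but pairing
  with an odd kernel gains one factor |x| from the test function, uniformly in the smoothing
  parameter and in the truncation radius.\<close>

lemma balls_borel [measurable]:
  "ball x r \<in> sets borel" "cball x r \<in> sets borel"
  by auto

text \<open>A dyadic comparison stands in for polar coordinates: the ball of radius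
  \<open>1 / 2 ^ n\<close> has area \<pi> / 4^n and carries the weight \<open>2 ^ Suc n\<close>, so
  the contributions form a geometric series.\<close>

lemma nn_integral_inverse_norm_ball:
  "(\<integral>\<^sup>+x\<in>ball (0::real^2) 1. ennreal (1 / norm x) \<partial>lborel) < \<infinity>"
proof -
  define f where "f = (\<lambda>n::nat. \<lambda>x::real^2. ennreal (2 ^ Suc n) * indicator (ball 0 (1 / 2 ^ n)) x)"
  have f_le: "f m x \<le> (\<Sum>n. f n x)" for m x
    using sum_le_suminf[of "\<lambda>n. f n x" "{m}"] by simp
  have bound: "ennreal (1 / norm x) * indicator (ball 0 1) x \<le> (\<Sum>n. f n x)" for x :: "real^2"
  proof (cases "x = 0 \<or> norm x \<ge> 1")
    case False
    define y where "y = 1 / norm x"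
    have y: "1 < y" using False by (auto simp: y_def field_simps)
    define n where "n = (LEAST n. y < 2 ^ n)"
    have n: "y < 2 ^ n" unfolding n_def by (rule LeastI_ex) (simp add: real_arch_pow)
    then obtain k where k: "n = Suc k" using y by (cases n) auto
    have "\<not> y < 2 ^ k" using not_less_Least[of k "\<lambda>n. y < 2 ^ n"] k n_def by auto
    hence "norm x \<le> 1 / 2 ^ k" using False by (auto simp: y_def field_simps)
    have "ennreal (1 / norm x) \<le> (\<Sum>n. f n x)"
    proof (cases "norm x < 1 / 2 ^ k")
      case True
      have "ennreal (1 / norm x) \<le> f k x"
        using True n k unfolding f_def by (auto simp: y_def intro!: ennreal_leI)
      also have "\<dots> \<le> (\<Sum>n. f n x)" by (rule f_le)
      finally show ?thesis .
    next
      case F: False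
      \<comment> \<open>On the outer edge of its dyadic shell \<open>x\<close> misses the open ball
        of index \<open>k\<close>. The next larger ball contains it, and its weight
        \<open>2 ^ Suc j\<close> is exactly \<open>1 / norm x\<close>.\<close>
      hence e: "norm x = 1 / 2 ^ k" using \<open>norm x \<le> 1 / 2 ^ k\<close> by linarith
      have "k \<noteq> 0" using e False by (cases k) auto
      then obtain j where j: "k = Suc j" by (cases k) auto
      have "ennreal (1 / norm x) \<le> f j x"
        using e j unfolding f_def by (simp add: indicator_def divide_strict_left_mono)
      also have "\<dots> \<le> (\<Sum>n. f n x)" by (rule f_le)
      finally show ?thesis .
    qed
    then show ?thesis using False by simp
  qed (auto simp: indicator_def)
  have "(\<integral>\<^sup>+x\<in>ball (0::real^2) 1. ennreal (1 / norm x) \<partial>lborel) \<le> (\<integral>\<^sup>+x. (\<Sum>n. f n x) \<partial>lborel)"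
    by (intro nn_integral_mono bound)
  also have "\<dots> = (\<Sum>n. (\<integral>\<^sup>+x. f n x \<partial>lborel))"
    unfolding f_def by (rule nn_integral_suminf) measurable
  also have "\<dots> = (\<Sum>n. ennreal (2 * pi * (1 / 2) ^ n))"
  proof (rule suminf_cong)
    fix n
    have "(\<integral>\<^sup>+x. f n x \<partial>lborel) = ennreal (2 ^ Suc n) * emeasure lborel (ball (0::real^2) (1 / 2 ^ n))"
      unfolding f_def by (subst nn_integral_cmult_indicator) auto
    also have "\<dots> = ennreal (2 ^ Suc n) * ennreal (pi * (1 / 2 ^ n) ^ 2)"
      by (subst emeasure_ball) (auto simp: unit_ball_vol_2)
    also have "\<dots> = ennreal (2 * pi * (1 / 2) ^ n)"
    proof -
      have "2 ^ Suc n * (pi * (1 / 2 ^ n)\<^sup>2) = 2 * pi * (1 / 2) ^ n"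
        by (simp add: power2_eq_square power_one_over)
      then show ?thesis by (subst ennreal_mult[symmetric]) auto
    qed
    finally show "(\<integral>\<^sup>+x. f n x \<partial>lborel) = ennreal (2 * pi * (1 / 2) ^ n)" .
  qed
  also have "\<dots> < \<infinity>"
    using summable_mult[OF summable_geometric[of "1/2::real"], of "2 * pi"]
    by (subst suminf_ennreal2) auto
  finally show ?thesis .
qed

lemma nn_integral_inverse_norm_cball:
  "(\<integral>\<^sup>+x\<in>cball (0::real^2) R. ennreal (1 / norm x) \<partial>lborel) < \<infinity>"
proof -
  have "(\<integral>\<^sup>+x\<in>cball (0::real^2) R. ennreal (1 / norm x) \<partial>lborel)
     \<le> (\<integral>\<^sup>+x. ennreal (1 / norm x) * indicator (ball 0 1) x + indicator (cball (0::real^2) R) x \<partial>lborel)"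
    by (intro nn_integral_mono) (auto simp: indicator_def divide_le_eq)
  also have "\<dots> = (\<integral>\<^sup>+x\<in>ball (0::real^2) 1. ennreal (1 / norm x) \<partial>lborel) + emeasure lborel (cball (0::real^2) R)"
    by (subst nn_integral_add) auto
  also have "\<dots> < \<infinity>" using nn_integral_inverse_norm_ball emeasure_lborel_cball_finite[of "0::real^2" R] by auto
  finally show ?thesis .
qed

lemma integrable_inverse_norm_cball:
  "integrable lborel (\<lambda>x::real^2. indicator (cball 0 R) x / norm x)"
proof (rule integrableI_nonneg)
  show "(\<integral>\<^sup>+ x. ennreal (indicat_real (cball (0::real^2) R) x / norm x) \<partial>lborel) < \<infinity>"
    using nn_integral_inverse_norm_cball[of R]
    by (rule le_less_trans[rotated]) (auto intro!: nn_integral_mono simp: indicator_def)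
  show "(\<lambda>x::real^2. indicat_real (cball 0 R) x / norm x) \<in> borel_measurable lborel"
    by measurable
qed simp

section \<open>Derivatives, supports and bounds of test functions\<close>

lemma Ck_Suc_has_derivative:
  "Ck (Suc k) f \<Longrightarrow> (f has_derivative frechet_derivative f (at x)) (at x)"
  by (simp add: frechet_derivative_works)

lemma frechet_derivative_euclidean_sum:
  fixes f :: "'a::euclidean_space \<Rightarrow> real"
  assumes "f differentiable at x"
  shows "frechet_derivative f (at x) h = (\<Sum>b\<in>Basis. (h \<bullet> b) * frechet_derivative f (at x) b)"
proof -
  interpret bounded_linear "frechet_derivative f (at x)"
    using assms by (simp add: frechet_derivative_works has_derivative_bounded_linear)
  have "frechet_derivative f (at x) (\<Sum>b\<in>Basis. (h \<bullet> b) *\<^sub>R b) = (\<Sum>b\<in>Basis. (h \<bullet> b) * frechet_derivative f (at x) b)"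
    by (simp add: sum scaleR)
  then show ?thesis by (simp add: euclidean_representation)
qed

lemma frechet_derivative_eq_0_outside:
  fixes f :: "'a::euclidean_space \<Rightarrow> real"
  assumes "x \<notin> closure {x. f x \<noteq> 0}"
  shows "frechet_derivative f (at x) = (\<lambda>_. 0)"
proof -
  have "(f has_derivative (\<lambda>_. 0)) (at x)"
  proof (rule has_derivative_transform_within_open)
    show "((\<lambda>_. 0) has_derivative (\<lambda>_. 0)) (at x)" by simp
    show "open (- closure {x. f x \<noteq> 0})" by auto
    show "x \<in> - closure {x. f x \<noteq> 0}" using assms by auto
    show "\<And>y. y \<in> - closure {x. f x \<noteq> 0} \<Longrightarrow> 0 = f y"
      using closure_subset[of "{x. f x \<noteq> 0}"] by (metis (mono_tags) ComplD mem_Collect_eq subsetD)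
  qed
  then show ?thesis by (rule frechet_derivative_at[symmetric])
qed

lemma bounded_of_continuous_support:
  assumes "continuous_on UNIV (g :: 'a::euclidean_space \<Rightarrow> real)" "\<And>x. norm x \<ge> r \<Longrightarrow> g x = 0"
  obtains M where "M > 0" "\<And>x. \<bar>g x\<bar> \<le> M"
proof -
  have "compact (g ` cball 0 r)"
    by (intro compact_continuous_image continuous_on_subset[OF assms(1)]) auto
  then have "bounded (g ` cball 0 r)" by (rule compact_imp_bounded)
  then obtain M where "\<forall>x\<in>g ` cball 0 r. norm x \<le> M" unfolding bounded_iff ..
  then have M: "\<bar>g x\<bar> \<le> M" if "x \<in> cball 0 r" for x using that by auto
  show thesis
  proof (rule that[of "max M 0 + 1"])
    show "\<bar>g x\<bar> \<le> max M 0 + 1" for x using M[of x] assms(2)[of x] by (cases "norm x \<le> r") auto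
  qed auto
qed

locale test_fun =
  fixes U :: "'a::euclidean_space set" and \<phi> :: "'a \<Rightarrow> real"
  assumes test: "test_function U \<phi>"
begin

lemma Ck_phi: "Ck k \<phi>" using test by (auto simp: test_function_def)

lemma derivative: "(\<phi> has_derivative frechet_derivative \<phi> (at x)) (at x)"
  using Ck_Suc_has_derivative[OF Ck_phi[of 1, unfolded One_nat_def]] .

lemma differentiable: "\<phi> differentiable (at x)"
  using derivative by (auto simp: differentiable_def)

lemma continuous: "continuous_on S \<phi>"
  using Ck_phi[of 0] continuous_on_subset by auto

lemma deriv_sum:
  "frechet_derivative \<phi> (at x) h = (\<Sum>b\<in>Basis. (h \<bullet> b) * frechet_derivative \<phi> (at x) b)"
  by (rule frechet_derivative_euclidean_sum[OF differentiable])

lemma continuous_partial: "continuous_on S (\<lambda>x. frechet_derivative \<phi> (at x) e)"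
proof -
  have "continuous_on S (\<lambda>x. frechet_derivative \<phi> (at x) b)" if "b \<in> Basis" for b
    using Ck_phi[of 1] that by (auto intro: continuous_on_subset)
  then show ?thesis by (subst deriv_sum) (intro continuous_intros)
qed

lemma support_bounded: obtains r where "r > 0"
  "\<And>x. norm x \<ge> r \<Longrightarrow> \<phi> x = 0" "\<And>x e. norm x \<ge> r \<Longrightarrow> frechet_derivative \<phi> (at x) e = 0"
proof -
  have "bounded (closure {x. \<phi> x \<noteq> 0})"
    using test by (auto simp: test_function_def compact_imp_bounded)
  then obtain a where a: "\<And>x. x \<in> closure {x. \<phi> x \<noteq> 0} \<Longrightarrow> norm x \<le> a"
    unfolding bounded_iff by blast
  show thesis
  proof (rule that[of "max a 0 + 1"])
    fix x e :: 'a assume x: "norm x \<ge> max a 0 + 1"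
    then have *: "x \<notin> closure {x. \<phi> x \<noteq> 0}" using a[of x] by auto
    then show "\<phi> x = 0" using closure_subset[of "{x. \<phi> x \<noteq> 0}"] by blast
    from * show "frechet_derivative \<phi> (at x) e = 0" 
      by (simp add: frechet_derivative_eq_0_outside)
  qed auto
qed

lemma bounded: obtains M where "M > 0" "\<And>x. \<bar>\<phi> x\<bar> \<le> M"
proof -
  obtain r where "\<And>x. norm x \<ge> r \<Longrightarrow> \<phi> x = 0" using support_bounded by metis
  then show thesis using bounded_of_continuous_support[OF continuous, of r] that by metis
qed

lemma partial_bounded: obtains M where "M > 0" "\<And>x. \<bar>frechet_derivative \<phi> (at x) e\<bar> \<le> M"
proof -
  obtain r where "\<And>x e. norm x \<ge> r \<Longrightarrow> frechet_derivative \<phi> (at x) e = 0"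
    using support_bounded by metis
  then show thesis using bounded_of_continuous_support[OF continuous_partial, of r e] that by metis
qed

text \<open>Applied to \<open>x\<close> and \<open>- x\<close>, this makes the odd part of a test
  function of order \<open>norm x\<close>, which compensates one power of the singularity.\<close>

lemma lipschitz: obtains M where "M > 0" "\<And>x y. \<bar>\<phi> x - \<phi> y\<bar> \<le> M * norm (x - y)"
proof -
  have "\<exists>M. 0 < M \<and> (\<forall>x. \<bar>frechet_derivative \<phi> (at x) b\<bar> \<le> M)" for b
    using partial_bounded[of b] by blast
  then obtain M where M: "\<And>b. M b > 0" "\<And>b x. \<bar>frechet_derivative \<phi> (at x) b\<bar> \<le> M b" by metis
  have b: "\<bar>frechet_derivative \<phi> (at x) h\<bar> \<le> norm h * (\<Sum>b\<in>Basis. M b)" for x h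
  proof -
    have "\<bar>frechet_derivative \<phi> (at x) h\<bar> \<le> (\<Sum>b\<in>Basis. \<bar>(h \<bullet> b) * frechet_derivative \<phi> (at x) b\<bar>)"
      by (subst deriv_sum) (rule sum_abs)
    also have "\<dots> \<le> (\<Sum>b\<in>Basis. norm h * M b)"
      by (intro sum_mono) (auto simp: abs_mult Basis_le_norm M intro!: mult_mono)
    finally show ?thesis by (simp add: sum_distrib_left)
  qed
  show thesis
  proof (rule that[of "\<Sum>b\<in>Basis. M b"])
    show "0 < (\<Sum>b\<in>Basis. M b)" by (intro sum_pos M) auto
    fix x y
    have "norm (\<phi> x - \<phi> y) \<le> (\<Sum>b\<in>Basis. M b) * norm (x - y)"
    proof (rule differentiable_bound[of UNIV \<phi> "\<lambda>x. frechet_derivative \<phi> (at x)"])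
      show "onorm (frechet_derivative \<phi> (at x)) \<le> (\<Sum>b\<in>Basis. M b)" for x
        using b[of x] by (intro onorm_le) (auto simp: mult.commute)
    qed (auto intro: derivative)
    then show "\<bar>\<phi> x - \<phi> y\<bar> \<le> (\<Sum>b\<in>Basis. M b) * norm (x - y)" by simp
  qed
qed

lemma measurable[measurable]: "\<phi> \<in> borel_measurable borel"
  by (rule borel_measurable_continuous_onI[OF continuous])

lemma measurable_partial[measurable]: "(\<lambda>x. frechet_derivative \<phi> (at x) e) \<in> borel_measurable borel"
  by (rule borel_measurable_continuous_onI[OF continuous_partial])

end

section \<open>Translations, reflections and integration by parts\<close>

lemma integrable_continuous_support:
  fixes g :: "'a::euclidean_space \<Rightarrow> real"
  assumes "continuous_on UNIV g" "\<And>x. norm x \<ge> r \<Longrightarrow> g x = 0"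
  shows "integrable lborel g"
proof -
  have "integrable lborel (\<lambda>x. indicator (cball 0 r) x *\<^sub>R g x)"
    by (rule borel_integrable_compact) (auto intro: continuous_on_subset[OF assms(1)])
  also have "(\<lambda>x. indicator (cball 0 r) x *\<^sub>R g x) = g"
    using assms(2) by (fastforce simp: indicator_def)
  finally show ?thesis .
qed

lemma integral_lborel_translation:
  fixes f :: "'a::euclidean_space \<Rightarrow> real"
  assumes [measurable]: "f \<in> borel_measurable borel"
  shows "(\<integral>x. f (x + c) \<partial>lborel) = (\<integral>x. f x \<partial>lborel)"
proof -
  have "(\<integral>x. f x \<partial>lborel) = (\<integral>x. f x \<partial>distr lborel borel ((+) c))"
    by (simp add: lborel_distr_plus)
  also have "\<dots> = (\<integral>x. f (c + x) \<partial>lborel)" by (rule integral_distr) measurable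
  finally show ?thesis by (simp add: add.commute)
qed

lemma integrable_lborel_translation:
  fixes f :: "'a::euclidean_space \<Rightarrow> real"
  assumes f: "integrable lborel f"
  shows "integrable lborel (\<lambda>x. f (x + c))"
proof -
  have [measurable]: "f \<in> borel_measurable borel" using f by auto
  have "integrable (distr lborel borel ((+) c)) f" using f by (simp add: lborel_distr_plus)
  then have "integrable lborel (\<lambda>x. f (c + x))" by (subst (asm) integrable_distr_eq) measurable
  then show ?thesis by (simp add: add.commute)
qed

lemma distr_lborel_uminus: "distr lborel borel uminus = (lborel :: 'a::euclidean_space measure)"
proof -
  have "(lborel :: 'a measure) = density (distr lborel borel (\<lambda>x. 0 + (-1) *\<^sub>R x)) (\<lambda>_. ennreal (\<bar>-1\<bar> ^ DIM('a)))"
    using lborel_affine[of "-1" "0::'a"] by simp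
  then show ?thesis by (simp add: density_1)
qed

lemma integral_lborel_uminus:
  fixes f :: "'a::euclidean_space \<Rightarrow> real"
  assumes [measurable]: "f \<in> borel_measurable borel"
  shows "(\<integral>x. f (- x) \<partial>lborel) = (\<integral>x. f x \<partial>lborel)"
proof -
  have "(\<integral>x. f x \<partial>lborel) = (\<integral>x. f x \<partial>distr lborel borel uminus)"
    by (simp add: distr_lborel_uminus)
  also have "\<dots> = (\<integral>x. f (- x) \<partial>lborel)" by (rule integral_distr) measurable
  finally show ?thesis by simp
qed

lemma integrable_lborel_uminus:
  fixes f :: "'a::euclidean_space \<Rightarrow> real"
  assumes f: "integrable lborel f"
  shows "integrable lborel (\<lambda>x. f (- x))"
proof -
  have [measurable]: "f \<in> borel_measurable borel" using f by auto
  have "integrable (distr lborel borel uminus) f" using f by (simp add: distr_lborel_uminus)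
  then show ?thesis by (subst (asm) integrable_distr_eq) measurable
qed

text \<open>Pairing an odd kernel with \<open>\<phi>\<close> only sees the odd part of \<open>\<phi>\<close>. It is \<open>O(\<bar>x\<bar>)\<close> and turns a
  singularity \<open>\<bar>x\<bar>\<^sup>-\<^sup>2\<close> in the plane into an integrable one.\<close>

lemma integral_odd_mult:
  fixes k \<phi> :: "'a::euclidean_space \<Rightarrow> real"
  assumes odd: "\<And>x. k (- x) = - k x" and int: "integrable lborel (\<lambda>x. k x * \<phi> x)"
  shows "(\<integral>x. k x * \<phi> x \<partial>lborel) = (\<integral>x. k x * ((\<phi> x - \<phi> (- x)) / 2) \<partial>lborel)"
proof -
  have "(\<lambda>x. k x * \<phi> x) \<in> borel_measurable borel" using int by auto
  from integral_lborel_uminus[OF this]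
  have "(\<integral>x. - (k x * \<phi> (- x)) \<partial>lborel) = (\<integral>x. k x * \<phi> x \<partial>lborel)" by (simp add: odd)
  moreover have int': "integrable lborel (\<lambda>x. - (k x * \<phi> (- x)))"
    using integrable_lborel_uminus[OF int] by (simp add: odd)
  ultimately have "(\<integral>x. k x * \<phi> x \<partial>lborel) = ((\<integral>x. k x * \<phi> x \<partial>lborel) + (\<integral>x. - (k x * \<phi> (- x)) \<partial>lborel)) / 2"
    by simp
  also have "\<dots> = (\<integral>x. k x * \<phi> x + - (k x * \<phi> (- x)) \<partial>lborel) / 2"
    by (subst Bochner_Integration.integral_add[OF int int']) simp
  also have "\<dots> = (\<integral>x. (k x * \<phi> x + - (k x * \<phi> (- x))) / 2 \<partial>lborel)" by simp
  also have "(\<lambda>x. (k x * \<phi> x + - (k x * \<phi> (- x))) / 2) = (\<lambda>x. k x * ((\<phi> x - \<phi> (- x)) / 2))"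
    by (simp add: fun_eq_iff field_simps)
  finally show ?thesis .
qed

text \<open>By translation invariance every difference quotient of \<open>f\<close> has integral
  zero, and the mean value bound dominates these quotients, so the limit has integral zero as well.
  For a product \<open>f\<close> this is integration by parts.\<close>

lemma integral_directional_derivative_eq_0:
  fixes f :: "'a::euclidean_space \<Rightarrow> real"
  assumes der: "\<And>x. (f has_derivative f' x) (at x)"
    and cont: "continuous_on UNIV (\<lambda>x. f' x e)"
    and f0: "\<And>x. norm x \<ge> r \<Longrightarrow> f x = 0" and f'0: "\<And>x. norm x \<ge> r \<Longrightarrow> f' x e = 0"
  shows "(\<integral>x. f' x e \<partial>lborel) = 0"
proof -
  have cf: "continuous_on UNIV f"
    using der by (meson continuous_at_imp_continuous_on has_derivative_continuous)
  have int_f: "integrable lborel f" by (rule integrable_continuous_support[OF cf f0])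
  have [measurable]: "f \<in> borel_measurable borel" using int_f by auto
  have [measurable]: "(\<lambda>x. f' x e) \<in> borel_measurable borel"
    by (rule borel_measurable_continuous_onI[OF cont])
  obtain M where M: "M > 0" "\<And>x. \<bar>f' x e\<bar> \<le> M"
    using bounded_of_continuous_support[OF cont f'0] by metis
  define h where "h = (\<lambda>n::nat. 1 / real (Suc n))"
  have h: "0 < h n" "h n \<le> 1" for n by (auto simp: h_def)
  have h0: "h \<longlonglongrightarrow> 0" unfolding h_def by (rule LIMSEQ_Suc[OF lim_1_over_n])
  have h_at: "filterlim h (at 0) sequentially"
    by (rule filterlim_atI[OF h0]) (simp add: h_def)
  have line: "((\<lambda>t. f (x + t *\<^sub>R e)) has_real_derivative f' (x + t *\<^sub>R e) e) (at t)" for x t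
  proof -
    interpret bounded_linear "f' (x + t *\<^sub>R e)" using der by (rule has_derivative_bounded_linear)
    have "((\<lambda>t. f (x + t *\<^sub>R e)) has_derivative (\<lambda>s. f' (x + t *\<^sub>R e) (s *\<^sub>R e))) (at t)"
      by (rule has_derivative_compose[OF _ der]) (auto intro!: derivative_eq_intros)
    then show ?thesis by (simp add: has_field_derivative_def scaleR mult.commute[of _ "f' (x + t *\<^sub>R e) e"])
  qed
  define s where "s = (\<lambda>n x. (f (x + h n *\<^sub>R e) - f x) / h n)"
  have "(\<lambda>n. \<integral>x. s n x \<partial>lborel) \<longlonglongrightarrow> (\<integral>x. f' x e \<partial>lborel)"
  proof (rule integral_dominated_convergence)
    \<comment> \<open>Since \<open>h n \<le> 1\<close>, a quotient can be nonzero only within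
      distance \<open>norm e\<close> of the support of \<open>f\<close>.\<close>
    show "integrable lborel (\<lambda>x. M * indicator (cball (0::'a) (r + norm e)) x)"
      using emeasure_lborel_cball_finite[of "0::'a" "r + norm e"]
      by (intro integrable_mult_right) (auto simp: integrable_indicator_iff)
    show "AE x in lborel. (\<lambda>n. s n x) \<longlonglongrightarrow> f' x e"
    proof (rule AE_I2)
      fix x
      have "(\<lambda>t. (f (x + t *\<^sub>R e) - f x) / t) \<midarrow>0\<rightarrow> f' x e"
        using line[of x 0] by (simp add: has_field_derivative_iff)
      then show "(\<lambda>n. s n x) \<longlonglongrightarrow> f' x e"
        unfolding s_def using h_at by (rule filterlim_compose)
    qed
    show "AE x in lborel. norm (s n x) \<le> M * indicator (cball 0 (r + norm e)) x" for n
    proof (rule AE_I2)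
      fix x
      show "norm (s n x) \<le> M * indicator (cball 0 (r + norm e)) x"
      proof (cases "norm x \<le> r + norm e")
        case True
        have "norm (f (x + h n *\<^sub>R e) - f (x + 0 *\<^sub>R e)) \<le> M * norm (h n - 0)"
          by (rule field_differentiable_bound[of UNIV "\<lambda>t. f (x + t *\<^sub>R e)" "\<lambda>t. f' (x + t *\<^sub>R e) e"])
             (auto intro: line M)
        then show ?thesis using True h[of n] by (simp add: s_def abs_divide field_simps)
      next
        case False
        have "norm (h n *\<^sub>R e) \<le> norm e" using h[of n] by (simp add: mult_left_le_one_le)
        then have "norm (x + h n *\<^sub>R e) \<ge> r"
          using False norm_triangle_ineq4[of "x + h n *\<^sub>R e" "h n *\<^sub>R e"] by simp
        moreover have "norm x \<ge> r" using False norm_ge_zero[of e] by linarith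
        ultimately show ?thesis using False by (simp add: s_def f0)
      qed
    qed
    show "(\<lambda>x. s n x) \<in> borel_measurable lborel" for n unfolding s_def by measurable
  qed measurable
  moreover have "(\<integral>x. s n x \<partial>lborel) = 0" for n
  proof -
    have "(\<integral>x. s n x \<partial>lborel) = (\<integral>x. f (x + h n *\<^sub>R e) - f x \<partial>lborel) / h n" by (simp add: s_def)
    also have "(\<integral>x. f (x + h n *\<^sub>R e) - f x \<partial>lborel) = 0"
      by (subst Bochner_Integration.integral_diff)
        (auto intro: integrable_lborel_translation int_f simp: integral_lborel_translation)
    finally show ?thesis by simp
  qed
  ultimately have "(\<lambda>n::nat. 0) \<longlonglongrightarrow> (\<integral>x. f' x e \<partial>lborel)" by simp
  then show ?thesis by (simp add: LIMSEQ_const_iff)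
qed

section \<open>The field and its distributional derivatives\<close>

text \<open>The parameter \<open>e > 0\<close> smooths the field at the origin without destroying its parity; \<open>e = 0\<close>
  gives the field itself.\<close>

definition reg_norm :: "real \<Rightarrow> real^2 \<Rightarrow> real" where
  "reg_norm e x = sqrt (x \<bullet> x + e)"

definition reg_field :: "real \<Rightarrow> 2 \<Rightarrow> real^2 \<Rightarrow> real" where
  "reg_field e i x = x$1 * x$i / reg_norm e x ^ 3"

text \<open>The partial derivative of \<open>reg_field e i\<close> in direction \<open>l\<close>
  (away from the origin if \<open>e = 0\<close>). The two conditionals are the Kronecker deltas of
  the product rule for \<open>x$1 * x$i\<close>.\<close>

definition kernel :: "real \<Rightarrow> 2 \<Rightarrow> 2 \<Rightarrow> real^2 \<Rightarrow> real" where
  "kernel e i l x = ((if l = 1 then x$i else 0) + (if l = i then x$1 else 0)) / reg_norm e x ^ 3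
     - 3 * x$1 * x$i * x$l / reg_norm e x ^ 5"

definition vfield :: "real^2 \<Rightarrow> real^2" where
  "vfield x = (x$1 / norm x ^ 3) *\<^sub>R x"

lemma reg_norm_0: "reg_norm 0 x = norm x" by (simp add: reg_norm_def norm_eq_sqrt_inner)

lemma reg_norm_ge_norm: "e \<ge> 0 \<Longrightarrow> norm x \<le> reg_norm e x"
  by (simp add: reg_norm_def norm_eq_sqrt_inner)

lemma reg_norm_pos: "e > 0 \<Longrightarrow> reg_norm e x > 0"
  by (simp add: reg_norm_def add_nonneg_pos)

lemma reg_field_0: "reg_field 0 i x = vfield x $ i"
  by (simp add: reg_field_def vfield_def reg_norm_0)

lemma abs_component_le_reg_norm: "e \<ge> 0 \<Longrightarrow> \<bar>x$i\<bar> \<le> reg_norm e x"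
  using component_le_norm_cart[of x i] reg_norm_ge_norm[of e x] by linarith

text \<open>Smoothing only enlarges the denominator, and every coordinate is at most
  \<open>reg_norm e x\<close>. The bound does not depend on \<open>e\<close>, as dominated
  convergence for \<open>e\<close> tending to 0 requires.\<close>

lemma reg_field_bound:
  assumes "e \<ge> 0" shows "\<bar>reg_field e i x\<bar> \<le> 1 / norm x"
proof (cases "x = 0")
  case False
  let ?N = "reg_norm e x"
  have N: "?N \<ge> norm x" "norm x > 0" using reg_norm_ge_norm assms False by auto
  then have N0: "?N > 0" by linarith
  have "\<bar>reg_field e i x\<bar> \<le> (?N * ?N) / ?N ^ 3"
    unfolding reg_field_def abs_divide abs_mult using N0
    by (intro divide_mono mult_mono abs_component_le_reg_norm assms) auto
  also have "\<dots> = 1 / ?N" using N0 by (simp add: power3_eq_cube)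
  also have "\<dots> \<le> 1 / norm x" using N N0 by (intro divide_left_mono) auto
  finally show ?thesis .
qed (simp add: reg_field_def)

lemma kernel_bound:
  assumes "e \<ge> 0" shows "\<bar>kernel e i l x\<bar> \<le> 5 / (norm x)\<^sup>2"
proof (cases "x = 0")
  case False
  let ?N = "reg_norm e x"
  have N: "?N \<ge> norm x" "norm x > 0" using reg_norm_ge_norm assms False by auto
  then have N0: "?N > 0" by linarith
  have c: "\<bar>x$j\<bar> \<le> ?N" for j by (rule abs_component_le_reg_norm[OF assms])
  have "\<bar>((if l = 1 then x$i else 0) + (if l = i then x$1 else 0)) / ?N ^ 3\<bar> \<le> (2 * ?N) / ?N ^ 3"
    using c[of i] c[of 1] N0 by (auto simp: abs_divide intro!: divide_right_mono)
  moreover have "\<bar>3 * x$1 * x$i * x$l / ?N ^ 5\<bar> \<le> (3 * ?N * ?N * ?N) / ?N ^ 5"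
    unfolding abs_divide abs_mult using N0 c by (intro divide_mono mult_mono) auto
  ultimately have "\<bar>kernel e i l x\<bar> \<le> (2 * ?N) / ?N ^ 3 + (3 * ?N * ?N * ?N) / ?N ^ 5"
    unfolding kernel_def by linarith
  \<comment> \<open>The constant is 2 from the product rule in the numerator plus 3 from
    differentiating the cube in the denominator.\<close>
  also have "\<dots> = 5 / ?N\<^sup>2" using N0 by (simp add: eval_nat_numeral divide_simps)
  also have "\<dots> \<le> 5 / (norm x)\<^sup>2" using N N0 by (intro divide_left_mono power_mono) auto
  finally show ?thesis .
qed (simp add: kernel_def)

lemma kernel_zero [simp]: "kernel e i l 0 = 0"
  by (simp add: kernel_def)

lemma kernel_odd: "kernel e i l (- x) = - kernel e i l x"
  by (simp add: kernel_def reg_norm_def minus_divide_left[symmetric])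

text \<open>This is the divergence off the origin. The field is \<open>x\<close> times a scalar
  homogeneous of degree -2, so in the plane Euler's identity gives 2 - 2 = 0.\<close>

lemma kernel_trace: "(\<Sum>i\<in>UNIV. kernel 0 i i x) = 0"
proof (cases "x = 0")
  case False
  have n: "norm x ^ 2 = x$1 * x$1 + x$2 * x$2"
    by (simp add: power2_norm_eq_inner inner_vec_def sum_2)
  have "(\<Sum>i\<in>UNIV. kernel 0 i i x) = 3 * x$1 / norm x ^ 3 - 3 * x$1 * (norm x ^ 2) / norm x ^ 5"
    unfolding n by (simp add: sum_2 kernel_def reg_norm_0 add_divide_distrib[symmetric] diff_divide_distrib[symmetric] algebra_simps)
  also have "\<dots> = 0" using False by (simp add: eval_nat_numeral)
  finally show ?thesis .
qed simp

lemma measurable_reg_norm [measurable]: "reg_norm e \<in> borel_measurable borel"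
  unfolding reg_norm_def by measurable

lemma measurable_reg_field [measurable]: "reg_field e i \<in> borel_measurable borel"
  unfolding reg_field_def by measurable

lemma measurable_kernel [measurable]: "kernel e i l \<in> borel_measurable borel"
  unfolding kernel_def by measurable

lemma measurable_vfield [measurable]: "vfield \<in> borel_measurable borel"
  unfolding vfield_def by measurable

lemma continuous_on_reg_norm: "continuous_on S (reg_norm e)"
  unfolding reg_norm_def by (intro continuous_intros)

lemma continuous_on_reg_field: "e > 0 \<Longrightarrow> continuous_on S (reg_field e i)"
  unfolding reg_field_def using reg_norm_pos[of e]
  by (intro continuous_intros continuous_on_reg_norm) (auto simp: less_imp_neq[symmetric])

lemma continuous_on_kernel: "e > 0 \<Longrightarrow> continuous_on S (kernel e i l)"
  unfolding kernel_def using reg_norm_pos[of e]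
  by (intro continuous_intros continuous_on_reg_norm; cases "l = 1"; cases "l = i")
    (auto simp: less_imp_neq[symmetric] intro!: continuous_on_add continuous_on_component)

lemma has_derivative_reg_field:
  assumes "e > 0"
  shows "(reg_field e i has_derivative
    (\<lambda>h. (h$1 * x$i + x$1 * h$i) / reg_norm e x ^ 3 - 3 * x$1 * x$i * (x \<bullet> h) / reg_norm e x ^ 5)) (at x)"
proof -
  have N: "reg_norm e x > 0" "x \<bullet> x + e > 0" using assms by (auto simp: reg_norm_pos add_nonneg_pos)
  have reg: "(reg_norm e has_derivative (\<lambda>h. (x \<bullet> h) / reg_norm e x)) (at x)"
    unfolding reg_norm_def using N(2)
    by (auto intro!: derivative_eq_intros simp: fun_eq_iff divide_simps inner_commute)
  have lin: "((\<lambda>x::real^2. x$j) has_derivative (\<lambda>h. h$j)) (at x)" for j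
    by (rule bounded_linear_imp_has_derivative) (rule bounded_linear_vec_nth)
  show ?thesis
    unfolding reg_field_def using N(1)
    by (auto intro!: derivative_eq_intros reg lin simp: fun_eq_iff eval_nat_numeral divide_simps)
       (simp add: algebra_simps)
qed

lemma lim_reg_field: "(\<lambda>n. reg_field (1 / real (Suc n)) i x) \<longlonglongrightarrow> reg_field 0 i x"
  and lim_kernel: "(\<lambda>n. kernel (1 / real (Suc n)) i l x) \<longlonglongrightarrow> kernel 0 i l x"
proof -
  have "(\<lambda>n. reg_norm (1 / real (Suc n)) x) \<longlonglongrightarrow> reg_norm 0 x"
    unfolding reg_norm_def by (intro tendsto_intros LIMSEQ_Suc[OF lim_1_over_n])
  moreover have "reg_norm 0 x \<noteq> 0" if "x \<noteq> 0" using that by (simp add: reg_norm_0)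
  ultimately have *: "x \<noteq> 0 \<Longrightarrow> (\<lambda>n. reg_field (1 / real (Suc n)) i x) \<longlonglongrightarrow> reg_field 0 i x"
    "x \<noteq> 0 \<Longrightarrow> (\<lambda>n. kernel (1 / real (Suc n)) i l x) \<longlonglongrightarrow> kernel 0 i l x"
    unfolding reg_field_def kernel_def by (auto intro!: tendsto_intros)
  show "(\<lambda>n. reg_field (1 / real (Suc n)) i x) \<longlonglongrightarrow> reg_field 0 i x"
    using *(1) by (cases "x = 0") (auto simp: reg_field_def)
  show "(\<lambda>n. kernel (1 / real (Suc n)) i l x) \<longlonglongrightarrow> kernel 0 i l x"
    using *(2) by (cases "x = 0") (auto simp: kernel_def)
qed

section \<open>Integration by parts across the singularity\<close>

context
  fixes U \<phi>
  assumes test: "test_function (U :: (real^2) set) \<phi>"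
begin

interpretation test_fun U \<phi> by (standard, rule test)

definition odd_part :: "real^2 \<Rightarrow> real" where "odd_part x = (\<phi> x - \<phi> (- x)) / 2"

lemma measurable_odd_part [measurable]: "odd_part \<in> borel_measurable borel"
  unfolding odd_part_def by measurable

text \<open>The kernel is of order |x|^(-2) and the odd part of order |x|, so a multiple of 1/|x| on
  a ball dominates the product. As \<open>w\<close> depends neither on \<open>e\<close> nor on a
  cutoff, it serves both the limit of vanishing smoothing and the principal value limit.\<close>

lemma kernel_odd_part_bound: obtains w where "integrable lborel w"
  "\<And>e i l x. e \<ge> 0 \<Longrightarrow> \<bar>kernel e i l x * odd_part x\<bar> \<le> w x"
proof -
  obtain M where M: "M > 0" "\<And>x y. \<bar>\<phi> x - \<phi> y\<bar> \<le> M * norm (x - y)" using lipschitz by metis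
  obtain r where r: "r > 0" "\<And>x. norm x \<ge> r \<Longrightarrow> \<phi> x = 0" using support_bounded by metis
  show thesis
  proof (rule that[of "\<lambda>x. (5 * M) * (indicator (cball 0 r) x / norm x)"])
    show "integrable lborel (\<lambda>x::real^2. 5 * M * (indicator (cball 0 r) x / norm x))"
      by (rule integrable_mult_right[OF integrable_inverse_norm_cball])
    fix e i l x assume e: "(e::real) \<ge> 0"
    show "\<bar>kernel e i l x * odd_part x\<bar> \<le> 5 * M * (indicator (cball 0 r) x / norm x)"
    proof (cases "norm x \<le> r \<and> x \<noteq> 0")
      case True
      have "\<bar>\<phi> x - \<phi> (- x)\<bar> \<le> M * norm (x - (- x))" by (rule M)
      also have "x - (- x) = 2 *\<^sub>R x" by (simp add: scaleR_2)
      finally have "\<bar>odd_part x\<bar> \<le> M * norm x" by (simp add: odd_part_def)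
      then have "\<bar>kernel e i l x * odd_part x\<bar> \<le> 5 / (norm x)\<^sup>2 * (M * norm x)"
        unfolding abs_mult by (intro mult_mono kernel_bound e) auto
      also have "\<dots> = 5 * M * (indicator (cball 0 r) x / norm x)"
        using True by (simp add: power2_eq_square)
      finally show ?thesis .
    next
      case False
      then have "odd_part x = 0" using r by (auto simp: odd_part_def)
      then show ?thesis using M(1) by simp
    qed
  qed
qed

lemma integrable_kernel_odd_part: "integrable lborel (\<lambda>x. kernel 0 i l x * odd_part x)"
proof -
  obtain w where "integrable lborel w" "\<And>e i l x. e \<ge> 0 \<Longrightarrow> \<bar>kernel e i l x * odd_part x\<bar> \<le> w x"
    using kernel_odd_part_bound by metis
  note w = this
  show ?thesis
  proof (rule Bochner_Integration.integrable_bound[OF w(1)])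
    show "AE x in lborel. norm (kernel 0 i l x * odd_part x) \<le> norm (w x)"
    proof (rule AE_I2)
      fix x
      have "\<bar>kernel 0 i l x * odd_part x\<bar> \<le> w x" by (rule w(2)) simp
      then show "norm (kernel 0 i l x * odd_part x) \<le> norm (w x)" by simp
    qed
  qed measurable
qed

text \<open>For \<open>e > 0\<close> the integrands are continuous with compact support, so the
  origin contributes nothing to the integration by parts. The passage to \<open>odd_part\<close> is
  made here, before the limit, because \<open>kernel 0 i l x * \<phi> x\<close> need not be
  integrable.\<close>

lemma integral_reg_field_partial_reg:
  assumes e: "e > 0"
  shows "(\<integral>x. reg_field e i x * frechet_derivative \<phi> (at x) (axis l 1) \<partial>lborel)
    = - (\<integral>x. kernel e i l x * odd_part x \<partial>lborel)"
proof -
  obtain r where r: "r > 0" "\<And>x. norm x \<ge> r \<Longrightarrow> \<phi> x = 0"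
    "\<And>x h. norm x \<ge> r \<Longrightarrow> frechet_derivative \<phi> (at x) h = 0" using support_bounded by metis
  let ?D = "\<lambda>x. frechet_derivative \<phi> (at x)"
  let ?F = "\<lambda>x h. (h$1 * x$i + x$1 * h$i) / reg_norm e x ^ 3 - 3 * x$1 * x$i * (x \<bullet> h) / reg_norm e x ^ 5"
  have F: "?F x (axis l 1) = kernel e i l x" for x
    by (auto simp: kernel_def axis_def inner_axis[unfolded axis_def] if_distrib cong: if_cong)
  have c1: "continuous_on UNIV (\<lambda>x. reg_field e i x * ?D x (axis l 1))"
    by (intro continuous_intros continuous_on_reg_field continuous_partial e)
  have c2: "continuous_on UNIV (\<lambda>x. kernel e i l x * \<phi> x)"
    by (intro continuous_intros continuous_on_kernel continuous e)
  have i1: "integrable lborel (\<lambda>x. reg_field e i x * ?D x (axis l 1))"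
    by (rule integrable_continuous_support[OF c1, of r]) (simp add: r)
  have i2: "integrable lborel (\<lambda>x. kernel e i l x * \<phi> x)"
    by (rule integrable_continuous_support[OF c2, of r]) (simp add: r)
  have "(\<integral>x. reg_field e i x * ?D x (axis l 1) + ?F x (axis l 1) * \<phi> x \<partial>lborel) = 0"
  proof (rule integral_directional_derivative_eq_0[where f = "\<lambda>x. reg_field e i x * \<phi> x" 
        and f' = "\<lambda>x h. reg_field e i x * ?D x h + ?F x h * \<phi> x" and r = r])
    show "((\<lambda>x. reg_field e i x * \<phi> x) has_derivative
          (\<lambda>h. reg_field e i x * ?D x h + ?F x h * \<phi> x)) (at x)" for x
      by (rule has_derivative_mult[OF has_derivative_reg_field[OF e] derivative])
    show "continuous_on UNIV (\<lambda>x. reg_field e i x * ?D x (axis l 1) + ?F x (axis l 1) * \<phi> x)"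
      unfolding F by (intro continuous_on_add c1 c2)
  qed (auto simp: r)
  then have "(\<integral>x. reg_field e i x * ?D x (axis l 1) \<partial>lborel) = - (\<integral>x. kernel e i l x * \<phi> x \<partial>lborel)"
    unfolding F using Bochner_Integration.integral_add[OF i1 i2] by simp
  also have "(\<integral>x. kernel e i l x * \<phi> x \<partial>lborel) = (\<integral>x. kernel e i l x * odd_part x \<partial>lborel)"
    unfolding odd_part_def by (rule integral_odd_mult[OF kernel_odd i2])
  finally show ?thesis .
qed

lemma field_partial_bound: obtains w where "integrable lborel w"
  "\<And>e x. e \<ge> 0 \<Longrightarrow> \<bar>reg_field e i x * frechet_derivative \<phi> (at x) h\<bar> \<le> w x"
proof -
  obtain r where r: "r > 0" "\<And>x h. norm x \<ge> r \<Longrightarrow> frechet_derivative \<phi> (at x) h = 0"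
    using support_bounded by metis
  obtain M where M: "M > 0" "\<And>x. \<bar>frechet_derivative \<phi> (at x) h\<bar> \<le> M"
    using partial_bounded by metis
  show thesis
  proof (rule that[of "\<lambda>x. M * (indicator (cball 0 r) x / norm x)"])
    show "integrable lborel (\<lambda>x::real^2. M * (indicator (cball 0 r) x / norm x))"
      by (rule integrable_mult_right[OF integrable_inverse_norm_cball])
    fix e x assume e: "(e::real) \<ge> 0"
    show "\<bar>reg_field e i x * frechet_derivative \<phi> (at x) h\<bar> \<le> M * (indicator (cball 0 r) x / norm x)"
    proof (cases "norm x \<le> r")
      case True
      have "\<bar>reg_field e i x * frechet_derivative \<phi> (at x) h\<bar> \<le> 1 / norm x * M"
        unfolding abs_mult by (intro mult_mono reg_field_bound e M) auto
      then show ?thesis using True by simp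
    qed (use r M in auto)
  qed
qed

text \<open>Both sides of the smoothed identity converge by dominated convergence. The kernel is odd
  for every \<open>e\<close>, so smoothing concentrates no mass at the origin.\<close>

lemma integral_reg_field_partial:
  "- (\<integral>x. reg_field 0 i x * frechet_derivative \<phi> (at x) (axis l 1) \<partial>lborel)
    = (\<integral>x. kernel 0 i l x * odd_part x \<partial>lborel)"
proof -
  let ?e = "\<lambda>n. 1 / real (Suc n)"
  let ?D = "\<lambda>x. frechet_derivative \<phi> (at x) (axis l 1)"
  obtain w where w: "integrable lborel w" "\<And>e i l x. e \<ge> 0 \<Longrightarrow> \<bar>kernel e i l x * odd_part x\<bar> \<le> w x"
    using kernel_odd_part_bound by metis
  obtain v where v: "integrable lborel v" "\<And>e x. e \<ge> 0 \<Longrightarrow> \<bar>reg_field e i x * ?D x\<bar> \<le> v x"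
    using field_partial_bound by metis
  have "(\<lambda>n. \<integral>x. reg_field (?e n) i x * ?D x \<partial>lborel) \<longlonglongrightarrow> (\<integral>x. reg_field 0 i x * ?D x \<partial>lborel)"
    by (rule integral_dominated_convergence[OF _ _ v(1)])
      (simp_all add: v(2) tendsto_mult lim_reg_field del: of_nat_Suc)
  moreover have "(\<lambda>n. \<integral>x. kernel (?e n) i l x * odd_part x \<partial>lborel) \<longlonglongrightarrow> (\<integral>x. kernel 0 i l x * odd_part x \<partial>lborel)"
    by (rule integral_dominated_convergence[OF _ _ w(1)])
      (simp_all add: w(2) tendsto_mult lim_kernel del: of_nat_Suc)
  then have "(\<lambda>n. \<integral>x. reg_field (?e n) i x * ?D x \<partial>lborel) \<longlonglongrightarrow> - (\<integral>x. kernel 0 i l x * odd_part x \<partial>lborel)"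
    by (subst integral_reg_field_partial_reg) (simp_all add: tendsto_minus del: of_nat_Suc)
  ultimately have "(\<integral>x. reg_field 0 i x * ?D x \<partial>lborel) = - (\<integral>x. kernel 0 i l x * odd_part x \<partial>lborel)"
    by (rule LIMSEQ_unique)
  then show ?thesis by simp
qed

text \<open>Truncation is radial and keeps the kernel odd, hence \<phi> may be replaced by its odd
  part while the cutoff is still positive. The remaining limit is dominated, and its value is the
  one obtained by smoothing.\<close>

lemma pv_kernel_limit:
  "((\<lambda>\<epsilon>. \<integral>x. (if norm x > \<epsilon> then kernel 0 i l x else 0) * \<phi> x \<partial>lborel)
     \<longlongrightarrow> (\<integral>x. kernel 0 i l x * odd_part x \<partial>lborel)) (at_right 0)"
  unfolding tendsto_at_iff_sequentially
proof (intro allI impI)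
  fix X :: "nat \<Rightarrow> real"
  assume X: "\<forall>n. X n \<in> {0<..} - {0}" "X \<longlonglongrightarrow> 0"
  let ?k = "\<lambda>n x. (if norm x > X n then kernel 0 i l x else 0)"
  obtain r where r: "r > 0" "\<And>x. norm x \<ge> r \<Longrightarrow> \<phi> x = 0" using support_bounded by metis
  obtain M where M: "M > 0" "\<And>x. \<bar>\<phi> x\<bar> \<le> M" using bounded by metis
  obtain w where w: "integrable lborel w" "\<And>e i l x. e \<ge> 0 \<Longrightarrow> \<bar>kernel e i l x * odd_part x\<bar> \<le> w x"
    using kernel_odd_part_bound by metis
  \<comment> \<open>For a fixed positive cutoff the kernel is bounded on the support, which
    justifies splitting \<phi> into even and odd parts.\<close>
  have int: "integrable lborel (\<lambda>x. ?k n x * \<phi> x)" for n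
  proof (rule Bochner_Integration.integrable_bound[where f = "\<lambda>x. (5 / (X n)\<^sup>2 * M) * indicator (cball 0 r) x"])
    show "integrable lborel (\<lambda>x::real^2. 5 / (X n)\<^sup>2 * M * indicator (cball 0 r) x)"
      using emeasure_lborel_cball_finite[of "0::real^2" r]
      by (intro integrable_mult_right) (auto simp: integrable_indicator_iff)
    have Xn: "X n > 0" using X(1) by auto
    show "AE x in lborel. norm (?k n x * \<phi> x) \<le> norm (5 / (X n)\<^sup>2 * M * indicator (cball 0 r) x)"
    proof (rule AE_I2)
      fix x
      show "norm (?k n x * \<phi> x) \<le> norm (5 / (X n)\<^sup>2 * M * indicator (cball 0 r) x)"
      proof (cases "norm x > X n \<and> norm x < r")
        case True
        have "\<bar>kernel 0 i l x\<bar> \<le> 5 / (norm x)\<^sup>2" by (rule kernel_bound) simp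
        also have "\<dots> \<le> 5 / (X n)\<^sup>2" using True Xn by (intro divide_left_mono power_mono mult_pos_pos zero_less_power) auto
        finally have "\<bar>kernel 0 i l x\<bar> * \<bar>\<phi> x\<bar> \<le> 5 / (X n)\<^sup>2 * M" by (intro mult_mono M) auto
        then show ?thesis using True M by (simp add: abs_mult)
      next
        case False
        then show ?thesis using r by auto
      qed
    qed
  qed measurable
  have "(\<integral>x. ?k n x * \<phi> x \<partial>lborel) = (\<integral>x. ?k n x * odd_part x \<partial>lborel)" for n
    unfolding odd_part_def by (rule integral_odd_mult[OF _ int]) (simp add: kernel_odd)
  moreover have "(\<lambda>n. \<integral>x. ?k n x * odd_part x \<partial>lborel) \<longlonglongrightarrow> (\<integral>x. kernel 0 i l x * odd_part x \<partial>lborel)"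
  proof (rule integral_dominated_convergence[OF _ _ w(1)])
    show "AE x in lborel. (\<lambda>n. ?k n x * odd_part x) \<longlonglongrightarrow> kernel 0 i l x * odd_part x"
    proof (rule AE_I2)
      fix x
      show "(\<lambda>n. ?k n x * odd_part x) \<longlonglongrightarrow> kernel 0 i l x * odd_part x"
      proof (cases "x = 0")
        case False
        then have "eventually (\<lambda>n. X n < norm x) sequentially" using X(2) by (intro order_tendstoD) auto
        then have "eventually (\<lambda>n. ?k n x * odd_part x = kernel 0 i l x * odd_part x) sequentially"
          by (rule eventually_mono) simp
        then show ?thesis by (rule tendsto_eventually)
      qed (simp cong: if_cong)
    qed
    show "AE x in lborel. norm (?k n x * odd_part x) \<le> w x" for n
    proof (rule AE_I2)
      fix x
      have "\<bar>kernel 0 i l x * odd_part x\<bar> \<le> w x" by (rule w(2)) simp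
      moreover from this have "0 \<le> w x" by linarith
      ultimately show "norm (?k n x * odd_part x) \<le> w x" by simp
    qed
  qed measurable
  ultimately show "((\<lambda>\<epsilon>. \<integral>x. (if norm x > \<epsilon> then kernel 0 i l x else 0) * \<phi> x \<partial>lborel) \<circ> X)
     \<longlonglongrightarrow> (\<integral>x. kernel 0 i l x * odd_part x \<partial>lborel)"
    by (simp add: o_def)
qed

end

section \<open>The angular functions on the unit circle\<close>

definition omega :: "2 \<Rightarrow> 2 \<Rightarrow> real^2 \<Rightarrow> real" where
  "omega i l x = (norm x)\<^sup>2 * kernel 0 i l x"

lemma omega_eq:
  "omega i l x = ((if l = 1 then x$i else 0) + (if l = i then x$1 else 0)) / norm x
     - 3 * x$1 * x$i * x$l / norm x ^ 3"
  by (cases "x = 0") (simp_all add: omega_def kernel_def reg_norm_0 right_diff_distrib eval_nat_numeral)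

lemma omega_div_norm: "omega i l x / (norm x)\<^sup>2 = kernel 0 i l x"
  by (cases "x = 0") (simp_all add: omega_def)

lemma measurable_omega [measurable]: "omega i l \<in> borel_measurable borel"
  unfolding omega_def by measurable

lemma zero_homogeneous_omega: "zero_homogeneous (omega i l)"
  unfolding zero_homogeneous_def
proof (intro allI impI)
  fix s x assume "(s::real) > 0"
  then show "omega i l (s *\<^sub>R x) = omega i l x"
    by (cases "x = 0") (simp_all add: omega_eq eval_nat_numeral divide_simps, auto simp: algebra_simps)
qed

lemma norm_circle_pt [simp]: "norm (circle_pt t) = 1"
  by (simp add: circle_pt_def norm_eq_sqrt_inner inner_vec_def sum_2 flip: power2_eq_square)

lemma circle_pt_nth [simp]: "circle_pt t $ 1 = cos t" "circle_pt t $ 2 = sin t"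
  by (simp_all add: circle_pt_def)

lemma sin_sq_mult: "sin t * sin t = 1 - cos t * (cos t :: real)"
  using sin_squared_eq[of t] by (simp add: power2_eq_square)

text \<open>One case analysis serves three purposes: the equal end values of \<open>P\<close> give
  mean zero, while the derivative \<open>p'\<close> gives continuity and bounded variation. In each
  case \<open>omega\<close> is a cubic trigonometric polynomial, integrated with the help of
  \<open>(sin t)\<^sup>2 + (cos t)\<^sup>2 = 1\<close>.\<close>

lemma omega_circle_primitive: obtains P p' where
  "\<And>t. (P has_real_derivative omega i l (circle_pt t)) (at t)" "P (2 * pi) = P 0"
  "\<And>t. ((\<lambda>t. omega i l (circle_pt t)) has_real_derivative p' t) (at t)" "continuous_on UNIV p'"
proof -
  consider "i = 1" "l = 1" | "i = 1" "l = 2" | "i = 2" "l = 1" | "i = 2" "l = 2"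
    using exhaust_2[of i] exhaust_2[of l] by auto
  then show thesis
  proof cases
    case 1
    then have o: "omega i l (circle_pt t) = 2 * cos t - 3 * cos t ^ 3" for t
      by (simp add: omega_eq power3_eq_cube)
    show ?thesis
    proof (rule that[of "\<lambda>t. - sin t + sin t ^ 3" "\<lambda>t. - 2 * sin t + 9 * (cos t)\<^sup>2 * sin t"])
      show "((\<lambda>t. - sin t + sin t ^ 3) has_real_derivative omega i l (circle_pt t)) (at t)" for t
        unfolding o by (auto intro!: derivative_eq_intros simp: eval_nat_numeral sin_sq_mult algebra_simps)
      show "((\<lambda>t. omega i l (circle_pt t)) has_real_derivative - 2 * sin t + 9 * (cos t)\<^sup>2 * sin t) (at t)" for t
        unfolding o by (auto intro!: derivative_eq_intros simp: eval_nat_numeral algebra_simps)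
    qed (auto intro!: continuous_intros)
  next
    case 2
    then have o: "omega i l (circle_pt t) = - 3 * (cos t)\<^sup>2 * sin t" for t
      by (simp add: omega_eq power2_eq_square)
    show ?thesis
    proof (rule that[of "\<lambda>t. cos t ^ 3" "\<lambda>t. 6 * cos t * (sin t)\<^sup>2 - 3 * cos t ^ 3"])
      show "((\<lambda>t. cos t ^ 3) has_real_derivative omega i l (circle_pt t)) (at t)" for t
        unfolding o by (auto intro!: derivative_eq_intros simp: eval_nat_numeral algebra_simps)
      show "((\<lambda>t. omega i l (circle_pt t)) has_real_derivative 6 * cos t * (sin t)\<^sup>2 - 3 * cos t ^ 3) (at t)" for t
        unfolding o by (auto intro!: derivative_eq_intros simp: eval_nat_numeral algebra_simps)
    qed (auto intro!: continuous_intros)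
  next
    case 3
    then have o: "omega i l (circle_pt t) = sin t - 3 * (cos t)\<^sup>2 * sin t" for t
      by (simp add: omega_eq power2_eq_square)
    show ?thesis
    proof (rule that[of "\<lambda>t. - cos t + cos t ^ 3" "\<lambda>t. cos t + 6 * cos t * (sin t)\<^sup>2 - 3 * cos t ^ 3"])
      show "((\<lambda>t. - cos t + cos t ^ 3) has_real_derivative omega i l (circle_pt t)) (at t)" for t
        unfolding o by (auto intro!: derivative_eq_intros simp: eval_nat_numeral algebra_simps)
      show "((\<lambda>t. omega i l (circle_pt t)) has_real_derivative cos t + 6 * cos t * (sin t)\<^sup>2 - 3 * cos t ^ 3) (at t)" for t
        unfolding o by (auto intro!: derivative_eq_intros simp: eval_nat_numeral algebra_simps)
    qed (auto intro!: continuous_intros)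
  next
    case 4
    then have o: "omega i l (circle_pt t) = cos t - 3 * cos t * (sin t)\<^sup>2" for t
      by (simp add: omega_eq power2_eq_square)
    show ?thesis
    proof (rule that[of "\<lambda>t. sin t - sin t ^ 3" "\<lambda>t. - sin t + 3 * sin t ^ 3 - 6 * (cos t)\<^sup>2 * sin t"])
      show "((\<lambda>t. sin t - sin t ^ 3) has_real_derivative omega i l (circle_pt t)) (at t)" for t
        unfolding o by (auto intro!: derivative_eq_intros simp: eval_nat_numeral algebra_simps)
      show "((\<lambda>t. omega i l (circle_pt t)) has_real_derivative - sin t + 3 * sin t ^ 3 - 6 * (cos t)\<^sup>2 * sin t) (at t)" for t
        unfolding o by (auto intro!: derivative_eq_intros simp: eval_nat_numeral algebra_simps)
    qed (auto intro!: continuous_intros)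
  qed
qed

lemma set_integrable_continuous_Icc:
  fixes f :: "real \<Rightarrow> real"
  assumes "continuous_on UNIV f"
  shows "set_integrable lebesgue {a..b} f"
  using absolutely_integrable_continuous_real[of a b f] continuous_on_subset[OF assms] by auto

lemma set_lebesgue_integral_FTC:
  fixes F f :: "real \<Rightarrow> real"
  assumes "\<And>t. (F has_real_derivative f t) (at t)" "continuous_on UNIV f" "a \<le> b"
  shows "set_lebesgue_integral lebesgue {a..b} f = F b - F a"
proof -
  have "(f has_integral F b - F a) {a..b}"
    using assms(1) by (intro fundamental_theorem_of_calculus assms(3))
      (auto simp: has_real_derivative_iff_has_vector_derivative[symmetric] intro: DERIV_subset)
  then show ?thesis
    using set_lebesgue_integral_eq_integral(2)[OF set_integrable_continuous_Icc[OF assms(2)]]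
    by (simp add: integral_unique)
qed

lemma omega_circle_continuous: "continuous_on UNIV (\<lambda>t. omega i l (circle_pt t))"
proof -
  obtain p' where "\<And>t. ((\<lambda>t. omega i l (circle_pt t)) has_real_derivative p' t) (at t)"
    using omega_circle_primitive by metis
  then show ?thesis by (intro continuous_at_imp_continuous_on) (auto intro: DERIV_isCont)
qed

lemma mean_zero_omega: "mean_zero_S1 (omega i l)"
proof -
  obtain P where "\<And>t. (P has_real_derivative omega i l (circle_pt t)) (at t)" "P (2 * pi) = P 0"
    using omega_circle_primitive by metis
  then show ?thesis unfolding mean_zero_S1_def
    by (subst set_lebesgue_integral_FTC[where F = P]) (auto intro: omega_circle_continuous)
qed

lemma in_Linf_omega: "in_Linf_S1 (omega i l)"
  unfolding in_Linf_S1_def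
proof
  show "(\<lambda>\<theta>. omega i l (circle_pt \<theta>)) \<in> borel_measurable borel"
    by (rule borel_measurable_continuous_onI[OF omega_circle_continuous])
  have "\<bar>omega i l (circle_pt t)\<bar> \<le> 5" for t
    using kernel_bound[of 0 i l "circle_pt t"] by (simp add: omega_def)
  then show "\<exists>C. AE \<theta> in lebesgue. \<bar>omega i l (circle_pt \<theta>)\<bar> \<le> C" by auto
qed

text \<open>On the circle \<open>omega i l\<close> is continuously differentiable. Integration by
  parts moves the derivative away from \<psi>, the boundary terms cancel by periodicity, and
  \<bar>\<psi>\<bar> \<le> 1 leaves at most 2 \<pi> times the maximum of the derivative.\<close>

lemma in_BV_omega: "in_BV_S1 (omega i l)"
proof -
  define p where "p = (\<lambda>t. omega i l (circle_pt t))"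
  have pc: "continuous_on UNIV p" unfolding p_def by (rule omega_circle_continuous)
  obtain p' where p': "\<And>t. (p has_real_derivative p' t) (at t)" and p'c: "continuous_on UNIV p'"
    unfolding p_def using omega_circle_primitive by metis
  have "bounded (p' ` {0..2*pi})"
    by (intro compact_imp_bounded compact_continuous_image continuous_on_subset[OF p'c]) auto
  then obtain M where "\<forall>y\<in>p' ` {0..2*pi}. norm y \<le> M" unfolding bounded_iff ..
  then have M: "\<bar>p' t\<bar> \<le> M" if "t \<in> {0..2*pi}" for t using that by auto
  have M0: "M \<ge> 0" using M[of 0] by auto
  show ?thesis
    unfolding in_BV_S1_def
  proof (intro conjI exI[of _ "M * (2 * pi - 0)"] allI impI)
    have "set_integrable lebesgue {0..2*pi} p" by (rule set_integrable_continuous_Icc[OF pc])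
    then show "set_integrable lebesgue {0..2*pi} (\<lambda>\<theta>. omega i l (circle_pt \<theta>))" by (simp add: p_def)
    fix \<psi> \<psi>' :: "real \<Rightarrow> real"
    assume a: "(\<forall>\<theta>. (\<psi> has_real_derivative \<psi>' \<theta>) (at \<theta>)) \<and> continuous_on UNIV \<psi>' \<and>
        (\<forall>\<theta>. \<psi> (\<theta> + 2*pi) = \<psi> \<theta>) \<and> (\<forall>\<theta>. \<bar>\<psi> \<theta>\<bar> \<le> 1)"
    then have psc: "continuous_on UNIV \<psi>"
      by (intro continuous_at_imp_continuous_on) (auto intro: DERIV_isCont)
    have i1: "set_integrable lebesgue {0..2*pi} (\<lambda>t. p t * \<psi>' t)"
      using a pc by (intro set_integrable_continuous_Icc continuous_intros) auto
    have i2: "set_integrable lebesgue {0..2*pi} (\<lambda>t. p' t * \<psi> t)"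
      using p'c psc by (intro set_integrable_continuous_Icc continuous_intros) auto
    have "set_lebesgue_integral lebesgue {0..2*pi} (\<lambda>t. p t * \<psi>' t + p' t * \<psi> t) = p (2*pi) * \<psi> (2*pi) - p 0 * \<psi> 0"
    proof (rule set_lebesgue_integral_FTC)
      show "((\<lambda>t. p t * \<psi> t) has_real_derivative p t * \<psi>' t + p' t * \<psi> t) (at t)" for t
        using DERIV_mult[OF p'[of t], of \<psi> "\<psi>' t"] a by (simp add: add.commute mult.commute)
    qed (use pc p'c psc a in \<open>auto intro!: continuous_intros\<close>)
    also have "\<dots> = 0"
    proof -
      have "p (2*pi) = p 0" by (simp add: p_def circle_pt_def)
      moreover have "\<psi> (0 + 2*pi) = \<psi> 0" using a by blast
      ultimately show ?thesis by simp
    qed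
    finally have "set_lebesgue_integral lebesgue {0..2*pi} (\<lambda>t. p t * \<psi>' t)
        = - set_lebesgue_integral lebesgue {0..2*pi} (\<lambda>t. p' t * \<psi> t)"
      using set_integral_add(2)[OF i1 i2] by simp
    also have "\<dots> = - integral {0..2*pi} (\<lambda>t. p' t * \<psi> t)"
      by (simp add: set_lebesgue_integral_eq_integral(2)[OF i2])
    also have "\<dots> \<le> norm (integral {0..2*pi} (\<lambda>t. p' t * \<psi> t))" by simp
    also have "\<dots> \<le> M * (2 * pi - 0)"
    proof (rule integral_bound)
      show "norm (p' t * \<psi> t) \<le> M" if "t \<in> {0..2*pi}" for t
        using mult_mono[OF M[OF that], of "\<bar>\<psi> t\<bar>" 1] a M0 by (simp add: abs_mult)
      show "continuous_on {0..2*pi} (\<lambda>t. p' t * \<psi> t)"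
        using continuous_on_subset[OF p'c] continuous_on_subset[OF psc] by (intro continuous_intros) auto
    qed simp
    finally show "set_lebesgue_integral lebesgue {0..2*pi} (\<lambda>\<theta>. omega i l (circle_pt \<theta>) * \<psi>' \<theta>) \<le> M * (2 * pi - 0)"
      by (simp add: p_def)
  qed
qed

section \<open>Representation of the derivatives by point masses\<close>

definition dirac0 :: "(real^2) measure" where
  "dirac0 = distr (count_space {()}) borel (\<lambda>_. 0)"

lemma finite_measure_dirac0: "finite_measure dirac0"
  unfolding dirac0_def by (intro finite_measure.finite_measure_distr finite_measure_count_space) auto

lemma sets_dirac0 [simp]: "sets dirac0 = sets borel"
  by (simp add: dirac0_def)

lemma integral_dirac0:
  fixes f :: "real^2 \<Rightarrow> real"
  assumes "f \<in> borel_measurable borel"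
  shows "(\<integral>x. f x \<partial>dirac0) = f 0"
  unfolding dirac0_def using assms
  by (subst integral_distr) (auto simp: lebesgue_integral_count_space_finite)

text \<open>In the required sum the angular functions carry no index \<open>l\<close> and the
  measures carry no index \<open>i\<close>. So \<open>j\<close> has to play the role of a direction:
  the kernel of index \<open>j\<close> represents the derivative in direction \<open>j\<close>, and
  the measures for direction \<open>l\<close> keep only the summand \<open>j = l\<close>. The map
  \<open>of_nat\<close> sends 1 and 2 to the two elements of the index type.\<close>

definition dirac_at_index :: "2 \<Rightarrow> nat \<Rightarrow> (real^2) signed_measure" where
  "dirac_at_index l j = (if of_nat j = l then dirac0 else null_measure borel, null_measure borel)"

lemma bounded_Radon_dirac: "bounded_Radon (dirac_at_index l j)"
proof -
  have "finite_measure (null_measure (borel :: (real^2) measure))" by (rule finite_measureI) simp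
  then show ?thesis by (simp add: bounded_Radon_def dirac_at_index_def finite_measure_dirac0)
qed

lemma truncated_conv_dirac:
  assumes "\<epsilon> \<ge> 0"
  shows "truncated_conv (omega i k) (dirac_at_index l j) \<epsilon> x
    = (if of_nat j = l then (if norm x > \<epsilon> then kernel 0 i k x else 0) else 0)"
proof -
  have "(\<integral>y. (if norm (x - y) > \<epsilon> then omega i k (x - y) / (norm (x - y))\<^sup>2 else 0) \<partial>dirac0)
    = (if norm (x - 0) > \<epsilon> then omega i k (x - 0) / (norm (x - 0))\<^sup>2 else 0)"
    by (rule integral_dirac0) measurable
  then show ?thesis
    by (simp add: truncated_conv_def signed_integral_def dirac_at_index_def omega_div_norm)
qed

text \<open>The set \<open>U\<close> is arbitrary: the point mass represents the derivatives on the
  whole plane, so that one choice of measures works for every radius.\<close>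

lemma weak_partial_vfield:
  "weak_partial_eq_pv_conv U l (\<lambda>x. vfield x $ i) 2 (\<lambda>j. omega i (of_nat j)) (dirac_at_index l)"
  unfolding weak_partial_eq_pv_conv_def
proof (intro allI impI)
  fix \<phi> assume test: "test_function U \<phi>"
  interpret test_fun U \<phi> by (standard, rule test)
  let ?J = "\<integral>x. kernel 0 i l x * odd_part \<phi> x \<partial>lborel"
  have pv: "has_pv_conv (omega i (of_nat j)) (dirac_at_index l j) \<phi> (if of_nat j = l then ?J else 0)" for j
  proof -
    let ?k = "\<lambda>\<epsilon> x. if of_nat j = l then (if norm x > \<epsilon> then kernel 0 i l x else 0) else 0"
    have "((\<lambda>\<epsilon>. \<integral>x. ?k \<epsilon> x * \<phi> x \<partial>lborel) \<longlongrightarrow> (if of_nat j = l then ?J else 0)) (at_right 0)"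
      using pv_kernel_limit[OF test, of i l] by (cases "of_nat j = l") simp_all
    moreover have "eventually (\<lambda>\<epsilon>. (\<integral>x. ?k \<epsilon> x * \<phi> x \<partial>lborel)
        = (\<integral>x. truncated_conv (omega i (of_nat j)) (dirac_at_index l j) \<epsilon> x * \<phi> x \<partial>lebesgue)) (at_right 0)"
      using eventually_at_right_less[of "0::real"]
    proof eventually_elim
      case (elim \<epsilon>)
      have "truncated_conv (omega i (of_nat j)) (dirac_at_index l j) \<epsilon> x = ?k \<epsilon> x" for x
        using elim by (auto simp: truncated_conv_dirac)
      then have "(\<integral>x. truncated_conv (omega i (of_nat j)) (dirac_at_index l j) \<epsilon> x * \<phi> x \<partial>lebesgue)
          = (\<integral>x. ?k \<epsilon> x * \<phi> x \<partial>lebesgue)" by simp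
      also have "\<dots> = (\<integral>x. ?k \<epsilon> x * \<phi> x \<partial>lborel)"
        by (rule integral_completion) measurable
      finally show ?case ..
    qed
    ultimately show ?thesis unfolding has_pv_conv_def by (rule Lim_transform_eventually)
  qed
  have "(\<Sum>j=1..2. if of_nat j = l then ?J else 0) = ?J"
    using exhaust_2[of l] by (auto simp: numeral_2_eq_2)
  moreover have "(\<integral>x. vfield x $ i * frechet_derivative \<phi> (at x) (axis l 1) \<partial>lebesgue)
      = (\<integral>x. reg_field 0 i x * frechet_derivative \<phi> (at x) (axis l 1) \<partial>lborel)"
    unfolding reg_field_0[symmetric] by (rule integral_completion) measurable
  ultimately show "\<exists>c. (\<forall>j\<in>{1..2}. has_pv_conv (omega i (of_nat j)) (dirac_at_index l j) \<phi> (c j)) \<and>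
      - (\<integral>x. vfield x $ i * frechet_derivative \<phi> (at x) (axis l 1) \<partial>lebesgue) = (\<Sum>j=1..2. c j)"
    using pv integral_reg_field_partial[OF test, of i l]
    by (intro exI[of _ "\<lambda>j. if of_nat j = l then ?J else 0"] conjI) (blast, simp only:)
qed

text \<open>Each derivative of the field, origin included, acts on \<phi> by integrating its kernel
  against \<open>odd_part\<close>. The pointwise identity \<open>kernel_trace\<close> is therefore
  enough, and no separate argument at the origin is required.\<close>

lemma weakly_div_free_vfield: "weakly_div_free vfield"
  unfolding weakly_div_free_def
proof (intro allI impI)
  fix \<phi> :: "real^2 \<Rightarrow> real" assume test: "test_function UNIV \<phi>"
  interpret test_fun UNIV \<phi> by (standard, rule test)
  let ?D = "\<lambda>x i. frechet_derivative \<phi> (at x) (axis i 1)"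
  have D: "frechet_derivative \<phi> (at x) (vfield x) = (\<Sum>i\<in>UNIV. reg_field 0 i x * ?D x i)" for x
  proof -
    interpret bounded_linear "frechet_derivative \<phi> (at x)" by (rule has_derivative_bounded_linear[OF derivative])
    have "frechet_derivative \<phi> (at x) (\<Sum>i\<in>UNIV. (vfield x $ i) *s axis i 1) = (\<Sum>i\<in>UNIV. reg_field 0 i x * ?D x i)"
      by (simp add: sum scaleR reg_field_0 scalar_mult_eq_scaleR)
    then show ?thesis by (simp add: basis_expansion)
  qed
  have int: "integrable lborel (\<lambda>x. reg_field 0 i x * ?D x i)" for i
  proof -
    obtain w where w: "integrable lborel w" "\<And>e x. e \<ge> 0 \<Longrightarrow> \<bar>reg_field e i x * ?D x i\<bar> \<le> w x"
      using field_partial_bound[OF test] by metis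
    show ?thesis
    proof (rule Bochner_Integration.integrable_bound[OF w(1)])
      show "AE x in lborel. norm (reg_field 0 i x * ?D x i) \<le> norm (w x)"
      proof (rule AE_I2)
        fix x
        have "\<bar>reg_field 0 i x * ?D x i\<bar> \<le> w x" by (rule w(2)) simp
        then show "norm (reg_field 0 i x * ?D x i) \<le> norm (w x)" by simp
      qed
    qed measurable
  qed
  have "(\<integral>x. frechet_derivative \<phi> (at x) (vfield x) \<partial>lebesgue)
      = (\<integral>x. (\<Sum>i\<in>UNIV. reg_field 0 i x * ?D x i) \<partial>lborel)"
    unfolding D by (rule integral_completion) measurable
  also have "\<dots> = (\<Sum>i\<in>UNIV. \<integral>x. reg_field 0 i x * ?D x i \<partial>lborel)"
    by (rule Bochner_Integration.integral_sum) (rule int)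
  also have "\<dots> = - (\<Sum>i\<in>UNIV. \<integral>x. kernel 0 i i x * odd_part \<phi> x \<partial>lborel)"
    using integral_reg_field_partial[OF test] by (simp add: sum_negf[symmetric] minus_equation_iff)
  also have "(\<Sum>i\<in>UNIV. \<integral>x. kernel 0 i i x * odd_part \<phi> x \<partial>lborel)
      = (\<integral>x. (\<Sum>i\<in>UNIV. kernel 0 i i x * odd_part \<phi> x) \<partial>lborel)"
    by (rule Bochner_Integration.integral_sum[symmetric]) (rule integrable_kernel_odd_part[OF test])
  also have "\<dots> = 0" by (simp add: sum_distrib_right[symmetric] kernel_trace)
  finally show "(\<integral>x. frechet_derivative \<phi> (at x) (vfield x) \<partial>lebesgue) = 0" by simp
qed

section \<open>Growth of the field\<close>

lemma norm_vfield_le: "norm (vfield x) \<le> 1 / norm x"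
proof (cases "x = 0")
  case False
  have "norm (vfield x) = \<bar>x$1\<bar> / norm x ^ 2"
    using False by (simp add: vfield_def eval_nat_numeral)
  also have "\<dots> \<le> norm x / norm x ^ 2" by (intro divide_right_mono component_le_norm_cart) simp
  also have "\<dots> = 1 / norm x" using False by (simp add: power2_eq_square)
  finally show ?thesis .
qed (simp add: vfield_def)

text \<open>The inner half of a splitting at radius 1: the singularity is integrable, and outside
  the unit ball the field is bounded. The same splitting yields both \<open>in_L1_plus_Linf\<close>
  and \<open>R1\<close>.\<close>

lemma integrable_vfield_unit_ball:
  "integrable lborel (\<lambda>x. indicator (cball 0 1) x *\<^sub>R ((1 / (1 + norm x)) *\<^sub>R vfield x))"
proof (rule Bochner_Integration.integrable_bound[OF integrable_inverse_norm_cball[of 1]])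
  have "norm ((1 / (1 + norm x)) *\<^sub>R vfield x) \<le> 1 / norm x" for x :: "real^2"
  proof -
    have "norm ((1 / (1 + norm x)) *\<^sub>R vfield x) \<le> norm (vfield x)"
      by (simp add: divide_le_eq mult_le_cancel_left1 add_nonneg_nonneg add_pos_nonneg)
    then show ?thesis using norm_vfield_le[of x] by linarith
  qed
  then show "AE x in lborel. norm (indicator (cball 0 1) x *\<^sub>R ((1 / (1 + norm x)) *\<^sub>R vfield x))
      \<le> norm (indicator (cball 0 1) x / norm x)"
    by (auto simp: indicator_def)
qed measurable

lemma vfield_weighted_bound:
  "norm (indicator (- cball 0 1) x *\<^sub>R ((1 / (1 + norm x)) *\<^sub>R vfield x)) \<le> 1"
proof (cases "norm x \<le> 1")
  case False
  have "norm (vfield x) \<le> 1 / norm x" by (rule norm_vfield_le)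
  also have "\<dots> \<le> 1" using False by (simp add: divide_le_eq)
  finally have "norm (vfield x) \<le> 1 + norm x" using norm_ge_zero[of x] by linarith
  then show ?thesis using False by (simp add: indicator_def divide_le_eq add_pos_nonneg abs_of_nonneg)
qed simp

lemma in_L1_plus_Linf_vfield: "in_L1_plus_Linf (\<lambda>x. norm (vfield x) / (norm x + 1))"
  unfolding in_L1_plus_Linf_def
proof (intro exI conjI)
  let ?V = "\<lambda>x. (1 / (1 + norm x)) *\<^sub>R vfield x"
  show "integrable lebesgue (\<lambda>x. norm (indicator (cball 0 1) x *\<^sub>R ?V x))"
    using integrable_norm[OF integrable_vfield_unit_ball] by (subst integrable_completion) measurable
  show "(\<lambda>x. norm (indicator (- cball 0 1) x *\<^sub>R ?V x)) \<in> borel_measurable lebesgue"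
    by (rule measurable_completion) measurable
  show "AE x in lebesgue. \<bar>norm (indicator (- cball 0 1) x *\<^sub>R ?V x)\<bar> \<le> 1"
    unfolding abs_norm_cancel by (rule AE_I2) (rule vfield_weighted_bound)
  show "AE x in lebesgue. norm (vfield x) / (norm x + 1)
      = norm (indicator (cball 0 1) x *\<^sub>R ?V x) + norm (indicator (- cball 0 1) x *\<^sub>R ?V x)"
    by (rule AE_I2) (simp add: indicator_def add.commute)
qed

section \<open>The two flows\<close>

definition sq_factor :: "real \<Rightarrow> real^2 \<Rightarrow> real" where
  "sq_factor t x = 1 + 2 * t * x$1 / norm x ^ 3"

text \<open>\<open>sq_factor t x\<close> is \<open>\<bar>X(t,x)\<bar>\<^sup>2 / \<bar>x\<bar>\<^sup>2\<close> up to its sign, which becomes negative once the trajectory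
  has passed the origin. The library's \<open>sqrt\<close> is odd, so \<open>sqrt (sq_factor t x)\<close> is negative from then
  on: \<open>\<kappa> = 1\<close> continues along the line, \<open>\<kappa> = -1\<close> along its mirror image.\<close>

definition bend :: "real \<Rightarrow> real \<Rightarrow> real" where
  "bend \<kappa> s = max s 0 + \<kappa> * min s 0"

definition flow :: "real \<Rightarrow> real \<Rightarrow> real^2 \<Rightarrow> real^2" where
  "flow \<kappa> t x = (sqrt (sq_factor t x) * x$1) *\<^sub>R axis 1 1
     + (bend \<kappa> (sqrt (sq_factor t x)) * x$2) *\<^sub>R axis 2 1"

lemma flow_nth: "flow \<kappa> t x $ 1 = sqrt (sq_factor t x) * x$1"
    "flow \<kappa> t x $ 2 = bend \<kappa> (sqrt (sq_factor t x)) * x$2"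
  by (simp_all add: flow_def axis_def)

lemma bend_eq: "bend \<kappa> s = (if s \<ge> 0 then 1 else \<kappa>) * s"
  by (simp add: bend_def)

lemma norm2_sq: "(norm (x::real^2))\<^sup>2 = (x$1)\<^sup>2 + (x$2)\<^sup>2"
  unfolding power2_norm_eq_inner by (simp add: inner_vec_def sum_2 power2_eq_square)

text \<open>Crossing the origin changes the direction of the point only by signs of its coordinates,
  so its distance from the origin is the same for both values of \<kappa>.\<close>

lemma norm_flow_sq:
  assumes "\<bar>\<kappa>\<bar> = 1" shows "(norm (flow \<kappa> t x))\<^sup>2 = \<bar>sq_factor t x\<bar> * (norm x)\<^sup>2"
proof -
  have k: "\<kappa>\<^sup>2 = 1" using assms by (metis one_power2 power2_abs)
  have "(bend \<kappa> s)\<^sup>2 = s\<^sup>2" for s by (simp add: bend_eq power_mult_distrib k)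
  moreover have "(sqrt q)\<^sup>2 = \<bar>q\<bar>" for q by (simp add: power2_eq_square)
  ultimately show ?thesis by (simp add: norm2_sq flow_nth power_mult_distrib distrib_left)
qed

lemma norm_flow:
  assumes "\<bar>\<kappa>\<bar> = 1" shows "norm (flow \<kappa> t x) = \<bar>sqrt (sq_factor t x)\<bar> * norm x"
proof (rule power2_eq_imp_eq)
  show "(norm (flow \<kappa> t x))\<^sup>2 = (\<bar>sqrt (sq_factor t x)\<bar> * norm x)\<^sup>2"
    by (simp add: norm_flow_sq[OF assms] power_mult_distrib) (simp add: power2_eq_square)
qed auto

lemma flow_bound:
  assumes "\<bar>\<kappa>\<bar> = 1" "\<bar>t\<bar> \<le> r" "norm x \<le> r" shows "norm (flow \<kappa> t x) \<le> 1 + r + r\<^sup>2"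
proof (rule power2_le_imp_le)
  have r: "r \<ge> 0" using assms(2) by linarith
  have "(norm (flow \<kappa> t x))\<^sup>2 = \<bar>sq_factor t x * (norm x)\<^sup>2\<bar>"
    by (simp add: norm_flow_sq[OF assms(1)] abs_mult)
  \<comment> \<open>The factor \<open>(norm x)\<^sup>2\<close> reduces the singular term of
    \<open>sq_factor\<close> to \<open>x$1 / norm x\<close>, which has modulus at most 1.\<close>
  also have "sq_factor t x * (norm x)\<^sup>2 = (norm x)\<^sup>2 + 2 * t * (x$1 / norm x)"
    by (cases "x = 0") (simp_all add: sq_factor_def distrib_right eval_nat_numeral)
  also have "\<bar>\<dots>\<bar> \<le> (norm x)\<^sup>2 + 2 * \<bar>t\<bar> * \<bar>x$1 / norm x\<bar>"
    by (simp add: abs_mult abs_triangle_ineq[THEN order_trans])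
  also have "\<dots> \<le> r\<^sup>2 + 2 * r * 1"
  proof (intro add_mono mult_mono power_mono assms)
    show "\<bar>x$1 / norm x\<bar> \<le> 1" by (cases "x = 0") (auto simp: divide_le_eq component_le_norm_cart)
  qed (use r in auto)
  also have "\<dots> \<le> (1 + r + r\<^sup>2)\<^sup>2"
    using r by (simp add: power2_eq_square algebra_simps)
  finally show "(norm (flow \<kappa> t x))\<^sup>2 \<le> (1 + r + r\<^sup>2)\<^sup>2" .
  show "0 \<le> 1 + r + r\<^sup>2" using r by simp
qed

lemma measurable_vec_nth [measurable (raw)]:
  fixes f :: "'b \<Rightarrow> real^'n"
  assumes "f \<in> borel_measurable M" shows "(\<lambda>x. f x $ i) \<in> borel_measurable M"
proof -
  have "(\<lambda>x::real^'n. x $ i) \<in> borel_measurable borel"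
    by (intro borel_measurable_continuous_onI continuous_intros)
  from measurable_compose[OF assms this] show ?thesis .
qed

lemma measurable_bend [measurable]: "bend \<kappa> \<in> borel_measurable borel"
  unfolding bend_def by measurable

lemma measurable_flow [measurable]: "flow \<kappa> t \<in> borel_measurable borel"
  unfolding flow_def sq_factor_def by measurable

lemma measurable_flow2 [measurable]: "(\<lambda>z. flow \<kappa> (fst z) (snd z)) \<in> borel_measurable (borel \<Otimes>\<^sub>M borel)"
  unfolding flow_def sq_factor_def by measurable

lemma continuous_flow_time: "continuous_on S (\<lambda>t. flow \<kappa> t x)"
proof -
  have "(\<lambda>t. sq_factor t x) = (\<lambda>t. 1 + t * (2 * x$1 / norm x ^ 3))"
    by (simp add: sq_factor_def fun_eq_iff)
  moreover have "continuous_on S (\<lambda>t. 1 + t * k)" for k :: real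
    by (intro continuous_intros)
  ultimately have "continuous_on S (\<lambda>t. sq_factor t x)" by (simp only:)
  then show ?thesis
    unfolding flow_def bend_def
    by (intro continuous_on_add continuous_on_scaleR continuous_on_mult continuous_on_max
        continuous_on_min continuous_on_real_sqrt continuous_on_const)
qed

section \<open>Inverse, equation of motion and Jacobian away from the origin\<close>

text \<open>Running time backwards also undoes the crossing: the factor turns into its reciprocal,
  which has the same sign, and the change of direction is an involution because
  \<open>\<kappa> * \<kappa> = 1\<close>.\<close>

lemma flow_inverse:
  assumes \<kappa>: "\<bar>\<kappa>\<bar> = 1" and x: "x \<noteq> 0" and q: "sq_factor t x \<noteq> 0"
  shows "sq_factor (- t) (flow \<kappa> t x) = 1 / sq_factor t x" "flow \<kappa> (- t) (flow \<kappa> t x) = x"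
proof -
  define s where "s = sqrt (sq_factor t x)"
  have s0: "s \<noteq> 0" using q by (simp add: s_def)
  have s2: "s * s = \<bar>sq_factor t x\<bar>" by (simp add: s_def)
  have a3: "\<bar>s\<bar> ^ 3 = \<bar>s\<bar> * \<bar>sq_factor t x\<bar>" using s2 by (simp add: power3_eq_cube mult.assoc abs_mult_self)
  have "sq_factor (- t) (flow \<kappa> t x) = 1 - 2 * t * (s * x$1) / (\<bar>s\<bar> ^ 3 * norm x ^ 3)"
    unfolding sq_factor_def[of "-t"] by (simp add: norm_flow[OF \<kappa>] flow_nth s_def power_mult_distrib)
  also have "\<dots> = 1 - (s / \<bar>s\<bar> ^ 3) * (sq_factor t x - 1)"
    by (simp add: sq_factor_def)
  \<comment> \<open>The odd root \<open>s\<close> has the sign of \<open>sq_factor t x\<close>, and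
    its square is the modulus, so both sides of the crossing obey the same formula.\<close>
  also have "s / \<bar>s\<bar> ^ 3 = 1 / sq_factor t x"
  proof (cases "sq_factor t x > 0")
    case True
    then have "s > 0" by (simp add: s_def)
    then show ?thesis using True a3 by simp
  next
    case False
    then have "s < 0" "sq_factor t x < 0" using q by (auto simp: s_def)
    then show ?thesis using a3 by simp
  qed
  also have "1 - 1 / sq_factor t x * (sq_factor t x - 1) = 1 / sq_factor t x"
    using q by (simp add: field_simps)
  finally show q': "sq_factor (- t) (flow \<kappa> t x) = 1 / sq_factor t x" .
  have k: "\<kappa> * \<kappa> = 1" using \<kappa> by (metis abs_mult_self mult_1)
  have "bend \<kappa> (1 / s) * bend \<kappa> s = 1" using s0 k by (simp add: bend_eq)
  then show "flow \<kappa> (- t) (flow \<kappa> t x) = x"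
    using s0 by (simp add: vec_eq_iff forall_2 flow_nth q' real_sqrt_divide s_def[symmetric] mult.assoc[symmetric])
qed

text \<open>Before and after the crossing the trajectory is \<open>sqrt (sq_factor t x)\<close>
  times a fixed vector, and the odd root has derivative \<open>1 / (2 * \<bar>s\<bar>)\<close> on
  either side of zero. In the field along the trajectory the sign of \<open>s\<close> enters twice
  and cancels.\<close>

lemma flow_has_vector_derivative:
  assumes \<kappa>: "\<bar>\<kappa>\<bar> = 1" and x: "x \<noteq> 0" and q: "sq_factor t x \<noteq> 0"
  shows "((\<lambda>t. flow \<kappa> t x) has_vector_derivative vfield (flow \<kappa> t x)) (at t)"
proof -
  define s where "s = sqrt (sq_factor t x)"
  define c where "c = (if s \<ge> 0 then 1 else \<kappa>)"
  have s0: "s \<noteq> 0" using q by (simp add: s_def)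
  define D where "D = x$1 / (\<bar>s\<bar> * norm x ^ 3)"
  have qd: "((\<lambda>t. sq_factor t x) has_real_derivative 2 * x$1 / norm x ^ 3) (at t)"
  proof -
    have "(\<lambda>t. sq_factor t x) = (\<lambda>t. 1 + t * (2 * x$1 / norm x ^ 3))"
      by (simp add: sq_factor_def fun_eq_iff)
    moreover have "((\<lambda>t. 1 + t * k) has_real_derivative k) (at t)" for k
      by (auto intro!: derivative_eq_intros)
    ultimately show ?thesis by (simp only:)
  qed
  have "(sqrt has_real_derivative 1 / (2 * \<bar>s\<bar>)) (at (sq_factor t x))"
    using q by (intro DERIV_real_sqrt_generic) (auto simp: s_def field_simps)
  from DERIV_chain2[OF this qd]
  have sd: "((\<lambda>t. sqrt (sq_factor t x)) has_real_derivative D) (at t)" by (simp add: D_def)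
  let ?L = "\<lambda>t. (sqrt (sq_factor t x)) *\<^sub>R (x$1 *\<^sub>R axis 1 1 + (c * x$2) *\<^sub>R axis 2 1) :: real^2"
  have "(?L has_vector_derivative D *\<^sub>R (x$1 *\<^sub>R axis 1 1 + (c * x$2) *\<^sub>R axis 2 1)) (at t)"
    using has_vector_derivative_scaleR[OF sd has_vector_derivative_const] by simp
  then have "((\<lambda>t. flow \<kappa> t x) has_vector_derivative D *\<^sub>R (x$1 *\<^sub>R axis 1 1 + (c * x$2) *\<^sub>R axis 2 1)) (at t)"
  proof (rule has_vector_derivative_transform_within_open)
    \<comment> \<open>The times on the same side of the crossing as \<open>t\<close>, where the
      coefficient \<open>c\<close> does not change.\<close>
    let ?U = "{t'. sqrt (sq_factor t' x) * s > 0}"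
    show "open ?U" unfolding sq_factor_def by (intro open_Collect_less continuous_intros) (use x in auto)
    have "s * s > 0" using s0 not_real_square_gt_zero[of s] by blast
    then show "t \<in> ?U" by (simp add: s_def[symmetric])
    show "\<And>t'. t' \<in> ?U \<Longrightarrow> ?L t' = flow \<kappa> t' x"
      by (auto simp: flow_def bend_eq c_def scaleR_add_right zero_less_mult_iff)
  qed
  also have "D *\<^sub>R (x$1 *\<^sub>R axis 1 1 + (c * x$2) *\<^sub>R axis 2 1) = vfield (flow \<kappa> t x)"
  proof -
    have "s * s / \<bar>s\<bar> ^ 3 = 1 / \<bar>s\<bar>" using s0 by (simp add: power3_eq_cube abs_mult_self)
    then have *: "s * x$1 / (\<bar>s\<bar> * norm x) ^ 3 * s = D"
    proof -
      have "s * x$1 / (\<bar>s\<bar> * norm x) ^ 3 * s = (s * s / \<bar>s\<bar> ^ 3) * (x$1 / norm x ^ 3)"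
        by (simp add: power_mult_distrib)
      then show ?thesis unfolding \<open>s * s / \<bar>s\<bar> ^ 3 = 1 / \<bar>s\<bar>\<close> by (simp add: D_def)
    qed
    have "vfield (flow \<kappa> t x) $ 1 = s * x$1 / (\<bar>s\<bar> * norm x) ^ 3 * s * x$1"
      "vfield (flow \<kappa> t x) $ 2 = s * x$1 / (\<bar>s\<bar> * norm x) ^ 3 * s * (c * x$2)"
      by (simp_all add: vfield_def norm_flow[OF \<kappa>] flow_nth s_def[symmetric] bend_eq c_def)
    then show ?thesis unfolding * by (simp add: vec_eq_iff forall_2 axis_def)
  qed
  finally show ?thesis .
qed

text \<open>Write q for \<open>sq_factor t x\<close>. Up to the factor \<open>c\<close> on the
  second coordinate, the map multiplies a point by the root \<open>s\<close> of q. As q - 1 is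
  homogeneous of degree -2, Euler's identity gives the derivative of the root in the direction
  \<open>x\<close> as - (q - 1) / \<bar>s\<bar>. The determinant becomes \<open>c\<close> times
  \<bar>q\<bar> - (s / \<bar>s\<bar>) (q - 1), that is \<open>c\<close> if q is positive and
  \<open>- c\<close> if q is negative.\<close>

lemma flow_has_derivative:
  assumes \<kappa>: "\<bar>\<kappa>\<bar> = 1" and x: "x \<noteq> 0" and q: "sq_factor t x \<noteq> 0"
  shows "\<exists>f'. (flow \<kappa> t has_derivative f') (at x) \<and> \<bar>det (matrix f')\<bar> = 1"
proof -
  define s where "s = sqrt (sq_factor t x)"
  define c where "c = (if s \<ge> 0 then 1 else \<kappa>)"
  define m where "m = norm x"
  have m: "m > 0" using x by (simp add: m_def)
  have s0: "s \<noteq> 0" using q by (simp add: s_def)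
  define v where "v = (\<lambda>h::real^2. (2 * t * h$1 / m ^ 3 - 6 * t * x$1 * (x \<bullet> h) / m ^ 5) / (2 * \<bar>s\<bar>))"
  have lin: "((\<lambda>x::real^2. x$j) has_derivative (\<lambda>h. h$j)) (at x)" for j
    by (rule bounded_linear_imp_has_derivative) (rule bounded_linear_vec_nth)
  have nd: "(norm has_derivative (\<lambda>h. (x \<bullet> h) / m)) (at x)"
    using has_derivative_norm[OF x] by (simp add: sgn_div_norm m_def divide_inverse mult.commute inner_commute)
  have qd: "(sq_factor t has_derivative (\<lambda>h. 2 * t * h$1 / m ^ 3 - 6 * t * x$1 * (x \<bullet> h) / m ^ 5)) (at x)"
  proof -
    have num: "((\<lambda>y::real^2. 2 * t * y$1) has_derivative (\<lambda>h. 2 * t * h$1)) (at x)"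
      by (intro has_derivative_mult_right lin)
    have cube: "((\<lambda>y. norm y ^ 3) has_derivative (\<lambda>h. 3 * m * (x \<bullet> h))) (at x)"
      using has_derivative_power[OF nd, of 3] m by (simp add: m_def[symmetric] power2_eq_square mult.commute mult.left_commute)
    have "((\<lambda>y::real^2. 1 + 2 * t * y$1 / norm y ^ 3) has_derivative
        (\<lambda>h. 0 + (2 * t * h$1 * norm x ^ 3 - 2 * t * x$1 * (3 * m * (x \<bullet> h))) / (norm x ^ 3 * norm x ^ 3))) (at x)"
      using x by (intro has_derivative_add has_derivative_const has_derivative_divide'[OF num cube]) simp
    also have "(\<lambda>h. 0 + (2 * t * h$1 * norm x ^ 3 - 2 * t * x$1 * (3 * m * (x \<bullet> h))) / (norm x ^ 3 * norm x ^ 3))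
       = (\<lambda>h. 2 * t * h$1 / m ^ 3 - 6 * t * x$1 * (x \<bullet> h) / m ^ 5)"
      using m by (simp add: fun_eq_iff m_def[symmetric] eval_nat_numeral divide_simps) (simp add: algebra_simps)
    finally show ?thesis unfolding sq_factor_def[abs_def] .
  qed
  have "(sqrt has_real_derivative 1 / (2 * \<bar>s\<bar>)) (at (sq_factor t x))"
    using q by (intro DERIV_real_sqrt_generic) (auto simp: s_def field_simps)
  from DERIV_compose_FDERIV[OF this qd]
  have sd: "((\<lambda>x. sqrt (sq_factor t x)) has_derivative v) (at x)" by (simp add: v_def)
  let ?L = "\<lambda>x. (sqrt (sq_factor t x) * x$1) *\<^sub>R axis 1 1 + (c * (sqrt (sq_factor t x) * x$2)) *\<^sub>R axis 2 1 :: real^2"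
  define f' where "f' = (\<lambda>h. (s * h$1 + v h * x$1) *\<^sub>R axis 1 1 + (c * (s * h$2 + v h * x$2)) *\<^sub>R axis 2 1 :: real^2)"
  have "(?L has_derivative f') (at x)"
    unfolding f'_def s_def
    by (intro has_derivative_add has_derivative_scaleR_left has_derivative_mult sd lin has_derivative_mult_right)
  then have "(flow \<kappa> t has_derivative f') (at x)"
  proof (rule has_derivative_transform_within_open)
    \<comment> \<open>The condition that the root keeps its sign, multiplied by powers of
      \<open>norm y\<close>: without a division the function involved is continuous on the whole
      plane, and openness is immediate.\<close>
    let ?U = "{y. y \<noteq> 0} \<inter> {y. norm y ^ 3 * (sqrt (norm y ^ 3 + 2 * t * y$1) * s) > 0}"
    have nq: "norm y ^ 3 * sq_factor t y = norm y ^ 3 + 2 * t * y$1" if "y \<noteq> 0" for y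
      using that by (simp add: sq_factor_def distrib_left)
    have iff: "norm y ^ 3 * (sqrt (norm y ^ 3 + 2 * t * y$1) * s) > 0 \<longleftrightarrow> sqrt (sq_factor t y) * s > 0" if "y \<noteq> 0" for y
      using that by (simp flip: nq add: real_sqrt_mult zero_less_mult_iff mult_less_0_iff)
    show "open ?U" by (intro open_Int open_Collect_less open_Collect_neq continuous_intros)
    have "s * s > 0" using s0 not_real_square_gt_zero[of s] by blast
    then show "x \<in> ?U" using x iff[OF x] by (simp add: s_def[symmetric])
    show "?L y = flow \<kappa> t y" if "y \<in> ?U" for y
      using that iff[of y] by (auto simp: flow_def bend_eq c_def zero_less_mult_iff)
  qed
  moreover have "\<bar>det (matrix f')\<bar> = 1"
  proof -
    have vx: "v (axis 1 1) * x$1 + v (axis 2 1) * x$2 = - (sq_factor t x - 1) / \<bar>s\<bar>"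
    proof -
      define a where "a = 2 * t / m ^ 3"
      define b where "b = 6 * t * x$1 / m ^ 5"
      have "v (axis 1 1) = (a - b * x$1) / (2 * \<bar>s\<bar>)" "v (axis 2 1) = (0 - b * x$2) / (2 * \<bar>s\<bar>)"
        by (simp_all add: v_def a_def b_def inner_axis, simp_all add: axis_def)
      then have "v (axis 1 1) * x$1 + v (axis 2 1) * x$2 = (a * x$1 - b * (x$1 * x$1 + x$2 * x$2)) / (2 * \<bar>s\<bar>)"
        by (simp add: add_divide_distrib[symmetric] diff_divide_distrib[symmetric] algebra_simps)
      also have "x$1 * x$1 + x$2 * x$2 = m\<^sup>2" unfolding m_def norm2_sq by (simp add: power2_eq_square)
      also have "b * m\<^sup>2 = 3 * a * x$1" using m by (simp add: a_def b_def eval_nat_numeral)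
      also have "(a * x$1 - 3 * a * x$1) / (2 * \<bar>s\<bar>) = - (a * x$1) / \<bar>s\<bar>" by simp
      also have "a * x$1 = sq_factor t x - 1" by (simp add: a_def sq_factor_def m_def)
      finally show ?thesis .
    qed
    have "det (matrix f') = c * (s * s + s * (v (axis 1 1) * x$1 + v (axis 2 1) * x$2))"
      by (simp add: det_2 matrix_def f'_def axis_def[of _ 1] algebra_simps)
    also have "\<dots> = c * (\<bar>sq_factor t x\<bar> - s / \<bar>s\<bar> * (sq_factor t x - 1))"
    proof -
      have "s * (- (sq_factor t x - 1) / \<bar>s\<bar>) = - (s / \<bar>s\<bar> * (sq_factor t x - 1))"
        by (simp only: divide_inverse) algebra
      moreover have "s * s = \<bar>sq_factor t x\<bar>" by (simp add: s_def)
      ultimately show ?thesis unfolding vx by simp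
    qed
    finally have det: "det (matrix f') = c * (\<bar>sq_factor t x\<bar> - s / \<bar>s\<bar> * (sq_factor t x - 1))" .
    have c: "\<bar>c\<bar> = 1" using \<kappa> by (simp add: c_def)
    show ?thesis
    proof (cases "sq_factor t x > 0")
      case True
      then have "s > 0" by (simp add: s_def)
      then show ?thesis using True c by (simp add: det)
    next
      case False
      then have "s < 0" "sq_factor t x < 0" using q by (auto simp: s_def)
      then show ?thesis using c by (simp add: det)
    qed
  qed
  ultimately show ?thesis by blast
qed

section \<open>Area under the flow\<close>

text \<open>A point reaches the origin exactly at time \<open>t\<close> only if |x|^2 = - 2 t cos
  \<theta>, which singles out at most one point on each ray.\<close>

lemma negligible_sq_factor_0: "negligible {x. sq_factor t x = 0}"
proof -
  \<comment> \<open>The origin solves the equation cleared of denominators and would destroy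
    uniqueness along rays. Cutting it off by a non-strict bound keeps each piece closed.\<close>
  define S where "S = (\<lambda>n::nat. {x::real^2. 1 / real (Suc n) \<le> norm x \<and> norm x ^ 3 + 2 * t * x$1 = 0})"
  have "negligible (S n)" for n
  proof (rule starlike_negligible[where a = 0])
    show "closed (S n)" unfolding S_def
      by (intro closed_Collect_conj closed_Collect_le closed_Collect_eq continuous_intros)
    fix c and x :: "real^2"
    assume a: "0 + c *\<^sub>R x \<in> S n" "0 \<le> c" "0 + x \<in> S n"
    have p: "0 < 1 / real (Suc n)" by simp
    have "0 < norm (c *\<^sub>R x)" "0 < norm x" using a p unfolding S_def by (auto simp del: of_nat_Suc norm_scaleR intro: less_le_trans)
    then have c: "c > 0" "norm x > 0" using a(2) by (auto simp: zero_less_mult_iff)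
    have "(c * norm x) ^ 3 + 2 * t * (c * x$1) = 0" "norm x ^ 3 + 2 * t * x$1 = 0"
      using a unfolding S_def by auto
    moreover have "c * norm x ^ 3 * (c * c - 1)
        = ((c * norm x) ^ 3 + 2 * t * (c * x$1)) - c * (norm x ^ 3 + 2 * t * x$1)"
      by (simp add: algebra_simps power3_eq_cube)
    ultimately have "c * norm x ^ 3 * (c * c - 1) = 0" by simp
    then have "c * c = 1" using c by simp
    then have "c\<^sup>2 = 1\<^sup>2" by (simp add: power2_eq_square)
    then show "c = 1" by (rule power2_eq_imp_eq) (use c(1) in simp_all)
  qed
  then have "negligible (\<Union>n. S n)" by (intro negligible_countable_Union) auto
  moreover have "{x. sq_factor t x = 0} \<subseteq> (\<Union>n. S n)"
  proof
    fix x assume "x \<in> {x. sq_factor t x = 0}"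
    then have x: "sq_factor t x = 0" by simp
    then have "x \<noteq> 0" by (intro notI) (simp add: sq_factor_def)
    then have "norm x > 0" by simp
    then obtain n where "inverse (real (Suc n)) < norm x" using reals_Archimedean by blast
    moreover have "norm x ^ 3 + 2 * t * x$1 = norm x ^ 3 * sq_factor t x"
      using \<open>norm x > 0\<close> by (simp add: sq_factor_def distrib_left)
    ultimately have "x \<in> S n" using x by (simp add: S_def inverse_eq_divide del: of_nat_Suc)
    then show "x \<in> (\<Union>n. S n)" by blast
  qed
  ultimately show ?thesis by (rule negligible_subset)
qed

text \<open>Up to a null set, the preimage of \<open>A\<close> is contained in the image of
  \<open>A\<close> under the flow for time \<open>- t\<close>. That map has a Jacobian of modulus 1
  at the points of \<open>V\<close>, so the change of variables estimate bounds the image.\<close>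

lemma emeasure_flow_vimage:
  assumes \<kappa>: "\<bar>\<kappa>\<bar> = 1" and A: "A \<in> sets borel"
  shows "emeasure lborel (flow \<kappa> t -` A) \<le> emeasure lborel A"
proof (cases "emeasure lborel A = \<infinity>")
  case False
  let ?F = "flow \<kappa> (- t)"
  define N where "N = insert 0 {x. sq_factor t x = 0}"
  define V where "V = {y::real^2. y \<noteq> 0} \<inter> {y. sq_factor (- t) y \<noteq> 0}"
  have "negligible N" unfolding N_def using negligible_sq_factor_0 by (simp add: negligible_insert)
  then have N: "N \<in> null_sets lebesgue" by (simp add: negligible_iff_null_sets)
  have sq: "sq_factor (- t) \<in> borel_measurable borel" unfolding sq_factor_def by measurable
  have "V = {y \<in> space borel. y \<noteq> 0 \<and> sq_factor (- t) y \<noteq> 0}" by (auto simp: V_def)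
  also have "\<dots> \<in> sets borel" using sq by measurable
  finally have V: "V \<in> sets borel" .
  have AV: "A \<inter> V \<in> sets borel" using A V by auto
  have fin: "emeasure lborel (A \<inter> V) \<le> emeasure lborel A" using A by (intro emeasure_mono) auto
  then have lm: "A \<inter> V \<in> lmeasurable"
    using AV False by (auto simp: fmeasurable_def top.not_eq_extremum less_top intro: le_less_trans)
  obtain f' where f': "\<And>y. y \<in> A \<inter> V \<Longrightarrow> (?F has_derivative f' y) (at y) \<and> \<bar>det (matrix (f' y))\<bar> = 1"
  proof -
    have "\<forall>y\<in>A \<inter> V. \<exists>f'. (?F has_derivative f') (at y) \<and> \<bar>det (matrix f')\<bar> = 1"
      by (auto simp: V_def intro!: flow_has_derivative \<kappa>)
    then show thesis using that by (metis bchoice)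
  qed
  have der: "(?F has_derivative f' y) (at y within A \<inter> V)" if "y \<in> A \<inter> V" for y
    using f'[OF that] has_derivative_at_withinI by blast
  have i1: "(\<lambda>y. 1::real) integrable_on (A \<inter> V)" using lm by (simp add: lmeasurable_iff_integrable_on)
  have int: "(\<lambda>y. \<bar>det (matrix (f' y))\<bar>) integrable_on (A \<inter> V)"
    by (rule integrable_eq[OF i1]) (simp add: f')
  have S: "A \<inter> V \<in> sets lebesgue" using lm by auto
  have im: "?F ` (A \<inter> V) \<in> lmeasurable" by (rule measurable_differentiable_image[OF S der int])
  have "measure lebesgue (?F ` (A \<inter> V)) \<le> integral (A \<inter> V) (\<lambda>y. \<bar>det (matrix (f' y))\<bar>)"
    by (rule measure_differentiable_image[OF S der int])
  also have "\<dots> = integral (A \<inter> V) (\<lambda>y. 1)" by (rule integral_cong) (simp add: f')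
  also have "\<dots> = measure lebesgue (A \<inter> V)" using lm by (simp add: lmeasure_integral)
  finally have le: "emeasure lebesgue (?F ` (A \<inter> V)) \<le> emeasure lebesgue (A \<inter> V)"
    using im lm by (simp add: emeasure_eq_measure2)
  \<comment> \<open>A point outside \<open>N\<close> is recovered from its position by
    \<open>flow_inverse\<close>, and this position lies in \<open>V\<close> because its factor for
    time \<open>- t\<close> is a reciprocal and thus nonzero.\<close>
  have sub: "flow \<kappa> t -` A \<subseteq> N \<union> ?F ` (A \<inter> V)"
  proof
    fix x assume x: "x \<in> flow \<kappa> t -` A"
    show "x \<in> N \<union> ?F ` (A \<inter> V)"
    proof (cases "x \<in> N")
      case False
      then have x0: "x \<noteq> 0" "sq_factor t x \<noteq> 0" by (auto simp: N_def)
      note inv = flow_inverse[OF \<kappa> x0]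
      have "norm (flow \<kappa> t x) \<noteq> 0" using x0 by (simp add: norm_flow[OF \<kappa>])
      then have "flow \<kappa> t x \<in> V" using inv(1) x0 by (auto simp: V_def)
      then have "?F (flow \<kappa> t x) \<in> ?F ` (A \<inter> V)" using x by blast
      then show ?thesis using inv(2) by simp
    qed simp
  qed
  have P: "flow \<kappa> t -` A \<in> sets borel"
    using measurable_sets[OF measurable_flow A, of \<kappa> t] by simp
  have "emeasure lborel (flow \<kappa> t -` A) = emeasure lebesgue (flow \<kappa> t -` A)" using P by simp
  also have "\<dots> \<le> emeasure lebesgue (N \<union> ?F ` (A \<inter> V))"
    using N im by (intro emeasure_mono[OF sub]) auto
  also have "\<dots> \<le> emeasure lebesgue N + emeasure lebesgue (?F ` (A \<inter> V))"
    using N im by (intro emeasure_subadditive) auto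
  also have "\<dots> \<le> 0 + emeasure lebesgue (A \<inter> V)" using N le by (intro add_mono) auto
  also have "\<dots> \<le> emeasure lborel A" using fin AV by simp
  finally show ?thesis .
qed simp

lemma nn_integral_flow_le:
  assumes \<kappa>: "\<bar>\<kappa>\<bar> = 1" and [measurable]: "f \<in> borel_measurable borel"
  shows "(\<integral>\<^sup>+x. f (flow \<kappa> t x) \<partial>lborel) \<le> (\<integral>\<^sup>+x. f x \<partial>lborel)"
proof -
  have "(\<integral>\<^sup>+x. f (flow \<kappa> t x) \<partial>lborel) = (\<integral>\<^sup>+x. f x \<partial>distr lborel borel (flow \<kappa> t))"
    by (rule nn_integral_distr[symmetric]) measurable
  also have "\<dots> \<le> (\<integral>\<^sup>+x. f x \<partial>lborel)"
  proof (rule nn_integral_mono_measure)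
    show "distr lborel borel (flow \<kappa> t) \<le> lborel"
    proof (subst le_measure, simp, safe)
      fix A assume "A \<in> sets (distr lborel borel (flow \<kappa> t))"
      then have A: "A \<in> sets borel" by simp
      then show "emeasure (distr lborel borel (flow \<kappa> t)) A \<le> emeasure lborel A"
        by (subst emeasure_distr) (auto intro: emeasure_flow_vimage \<kappa>)
    qed
  qed simp
  finally show ?thesis .
qed

lemma measurable_flow_pair [measurable]:
  "(\<lambda>z. flow \<kappa> (fst z) (snd z)) \<in> borel_measurable borel"
  using measurable_flow2[of \<kappa>] by (simp add: borel_prod)

lemma flow_0: "flow \<kappa> 0 x = x"
  by (simp add: vec_eq_iff forall_2 flow_nth sq_factor_def bend_eq)

section \<open>Integrability, continuity and compressibility conditions\<close>

lemma bounded_logL_loc_flow: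
  assumes \<kappa>: "\<bar>\<kappa>\<bar> = 1" shows "bounded_logL_loc 0 T (flow \<kappa>)"
  unfolding bounded_logL_loc_def
proof (intro allI impI)
  fix r :: real assume "r > 0"
  define s where "s = max r T"
  define c where "c = ln (1 + (1 + s + s\<^sup>2))"
  have "(\<integral>\<^sup>+x\<in>ball 0 r. ennreal (ln (1 + norm (flow \<kappa> t x))) \<partial>lebesgue)
      \<le> ennreal (c * measure lborel (ball (0::real^2) r))" if t: "t \<in> {0..T}" for t
  proof -
    have "ennreal (ln (1 + norm (flow \<kappa> t x))) * indicator (ball 0 r) x \<le> ennreal c * indicator (ball 0 r) x" for x
    proof (cases "norm x < r")
      case True
      have "norm (flow \<kappa> t x) \<le> 1 + s + s\<^sup>2"
        using t True by (intro flow_bound \<kappa>) (auto simp: s_def)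
      then have "ln (1 + norm (flow \<kappa> t x)) \<le> c"
        unfolding c_def by (intro ln_mono) (auto simp: add_pos_nonneg intro: less_le_trans)
      then show ?thesis using True by (simp add: ennreal_leI)
    qed simp
    then have "(\<integral>\<^sup>+x\<in>ball 0 r. ennreal (ln (1 + norm (flow \<kappa> t x))) \<partial>lebesgue)
        \<le> (\<integral>\<^sup>+x. ennreal c * indicator (ball (0::real^2) r) x \<partial>lebesgue)"
      by (intro nn_integral_mono)
    also have "\<dots> = ennreal c * emeasure lebesgue (ball (0::real^2) r)"
      by (rule nn_integral_cmult_indicator) simp
    also have "emeasure lebesgue (ball (0::real^2) r) = ennreal (measure lborel (ball (0::real^2) r))"
      using emeasure_lborel_ball_finite[of "0::real^2" r] by (simp add: emeasure_eq_ennreal_measure)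
    also have "ennreal c * \<dots> = ennreal (c * measure lborel (ball (0::real^2) r))"
      by (rule ennreal_mult''[symmetric]) simp
    finally show ?thesis .
  qed
  then show "\<exists>C. \<forall>t\<in>{0..T}. (\<integral>\<^sup>+x\<in>ball 0 r. ennreal (ln (1 + norm (flow \<kappa> t x))) \<partial>lebesgue) \<le> ennreal C"
    by blast
qed

text \<open>Every single trajectory is continuous in time, also when it crosses the origin.
  Dominated convergence on a ball turns this into convergence in measure.\<close>

lemma continuous_L0_loc_flow: "continuous_L0_loc 0 T (flow \<kappa>)"
  unfolding continuous_L0_loc_def
proof (intro conjI ballI allI impI)
  show "flow \<kappa> t \<in> borel_measurable lebesgue" for t
    by (rule measurable_completion) measurable
  fix t r \<epsilon> :: real assume "r > 0" and \<epsilon>: "\<epsilon> > 0"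
  let ?A = "\<lambda>s. {x \<in> ball 0 r. norm (flow \<kappa> s x - flow \<kappa> t x) > \<epsilon>}"
  have A: "?A s \<in> sets borel" for s
  proof -
    have "?A s = {x \<in> space borel. x \<in> ball 0 r \<and> norm (flow \<kappa> s x - flow \<kappa> t x) > \<epsilon>}" by auto
    also have "\<dots> \<in> sets borel" by measurable
    finally show ?thesis .
  qed
  show "((\<lambda>s. measure lebesgue (?A s)) \<longlongrightarrow> 0) (at t within {0..T})"
    unfolding tendsto_at_iff_sequentially
  proof (intro allI impI)
    fix S :: "nat \<Rightarrow> real" assume S: "S \<longlonglongrightarrow> t"
    have "(\<lambda>n. \<integral>x. indicator (?A (S n)) x \<partial>lborel) \<longlonglongrightarrow> integral\<^sup>L lborel (\<lambda>x::real^2. 0::real)"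
    proof (rule integral_dominated_convergence)
      show "integrable lborel (\<lambda>x. indicator (ball (0::real^2) r) x :: real)"
        using emeasure_lborel_ball_finite[of "0::real^2" r] by (simp add: integrable_indicator_iff)
      show "AE x in lborel. (\<lambda>n. indicator (?A (S n)) x) \<longlonglongrightarrow> (0::real)"
      proof (rule AE_I2)
        fix x
        have "continuous_on UNIV (\<lambda>s. flow \<kappa> s x)" by (rule continuous_flow_time)
        then have "isCont (\<lambda>s. flow \<kappa> s x) t" by (simp add: continuous_on_eq_continuous_at)
        then have "(\<lambda>n. flow \<kappa> (S n) x) \<longlonglongrightarrow> flow \<kappa> t x" using S by (rule isCont_tendsto_compose)
        then have "eventually (\<lambda>n. dist (flow \<kappa> (S n) x) (flow \<kappa> t x) < \<epsilon>) sequentially"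
          using \<epsilon> by (rule tendstoD)
        then have "eventually (\<lambda>n. indicator (?A (S n)) x = (0::real)) sequentially"
          by (rule eventually_mono) (simp add: dist_norm)
        then show "(\<lambda>n. indicator (?A (S n)) x) \<longlonglongrightarrow> (0::real)" by (rule tendsto_eventually)
      qed
      show "AE x in lborel. norm (indicator (?A (S n)) x :: real) \<le> indicator (ball 0 r) x" for n
        by (rule AE_I2) (simp add: indicator_def)
      show "(\<lambda>x. indicator (?A (S n)) x :: real) \<in> borel_measurable lborel" for n
        by (rule borel_measurable_indicator) (simp add: A)
    qed simp
    then show "((\<lambda>s. measure lebesgue (?A s)) \<circ> S) \<longlonglongrightarrow> 0" using A by (simp add: o_def)
  qed
qed

text \<open>The area estimate concerns Borel sets, while \<open>f\<close> is only Lebesgue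
  measurable. A Borel representative is used instead; the null set where it differs from
  \<open>f\<close> has a null preimage by that same estimate.\<close>

lemma flow_compressible:
  assumes \<kappa>: "\<bar>\<kappa>\<bar> = 1" and f: "f \<in> borel_measurable lebesgue" "\<And>x. 0 \<le> f x"
  shows "(\<integral>\<^sup>+x. ennreal (f (flow \<kappa> t x)) \<partial>lebesgue) \<le> (\<integral>\<^sup>+x. ennreal (f x) \<partial>lebesgue)"
proof -
  obtain g where g [measurable]: "g \<in> borel_measurable lborel" and "AE x in lborel. f x = g x"
    using completion_ex_borel_measurable_real[OF f(1)] by blast
  then obtain N where N: "N \<in> null_sets lborel" "{x. f x \<noteq> g x} \<subseteq> N"
    by (auto elim!: AE_E simp: null_sets_def)
  have "flow \<kappa> t -` N \<in> sets borel"
    using measurable_sets[OF measurable_flow, of N \<kappa> t] N by (simp add: null_sets_def)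
  moreover have "emeasure lborel (flow \<kappa> t -` N) \<le> emeasure lborel N"
    using N by (intro emeasure_flow_vimage \<kappa>) (simp add: null_sets_def)
  ultimately have "flow \<kappa> t -` N \<in> null_sets lborel"
    using N by (simp add: null_sets_def)
  then have "AE x in lborel. f (flow \<kappa> t x) = g (flow \<kappa> t x)"
    by (rule AE_I') (use N in auto)
  then have "(\<integral>\<^sup>+x. ennreal (f (flow \<kappa> t x)) \<partial>lborel) = (\<integral>\<^sup>+x. ennreal (g (flow \<kappa> t x)) \<partial>lborel)"
    by (intro nn_integral_cong_AE) auto
  also have "\<dots> \<le> (\<integral>\<^sup>+x. ennreal (g x) \<partial>lborel)"
    by (rule nn_integral_flow_le[OF \<kappa>]) measurable
  also have "\<dots> = (\<integral>\<^sup>+x. ennreal (f x) \<partial>lborel)"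
    using \<open>AE x in lborel. f x = g x\<close> by (intro nn_integral_cong_AE) auto
  finally show ?thesis by (simp add: nn_integral_completion)
qed

lemma strip_in_sets_lebesgue: "{a<..<b::real} \<times> (UNIV :: (real^2) set) \<in> sets lebesgue"
proof -
  have "open ({a<..<b} \<times> (UNIV :: (real^2) set))" by (intro open_Times) auto
  then show ?thesis by simp
qed

lemma R1_vfield: "R1 T (\<lambda>t. vfield)"
  unfolding R1_def
proof (intro exI conjI)
  let ?S = "{0<..<T} \<times> (UNIV :: (real^2) set)"
  let ?V = "\<lambda>x. (1 / (1 + norm x)) *\<^sub>R vfield x"
  let ?g = "\<lambda>x. indicator (cball 0 1) x *\<^sub>R ?V x"
  have fin: "emeasure lborel {0<..<T} < \<infinity>" by (cases "0 \<le> T") auto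
  have "integrable (lborel \<Otimes>\<^sub>M lborel) (\<lambda>z. indicator {0<..<T} (fst z) *\<^sub>R ?g (snd z))"
  proof (rule lborel_pair.Fubini_integrable)
    show "(\<lambda>z. indicator {0<..<T} (fst z) *\<^sub>R ?g (snd z)) \<in> borel_measurable (lborel \<Otimes>\<^sub>M lborel)"
      by measurable
    have "integrable lborel (\<lambda>t::real. indicator {0<..<T} t *\<^sub>R (\<integral>x. norm (?g x) \<partial>lborel))"
      using fin by (intro integrable_scaleR_left) (simp add: integrable_indicator_iff)
    then show "integrable lborel (\<lambda>t. \<integral>x. norm (indicator {0<..<T} (fst (t, x)) *\<^sub>R ?g (snd (t, x))) \<partial>lborel)"
    proof -
      have "(\<integral>x. norm (indicator {0<..<T} t *\<^sub>R ?g x) \<partial>lborel)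
          = indicator {0<..<T} t *\<^sub>R (\<integral>x. norm (?g x) \<partial>lborel)" for t
        by (cases "t \<in> {0<..<T}") simp_all
      then show ?thesis using \<open>integrable lborel _\<close> by (simp only: fst_conv snd_conv)
    qed
    show "AE t in lborel. integrable lborel (\<lambda>x. indicator {0<..<T} (fst (t, x)) *\<^sub>R ?g (snd (t, x)))"
      using integrable_vfield_unit_ball by (intro AE_I2) (simp only: fst_conv snd_conv, rule integrable_scaleR_right)
  qed
  then have "integrable lborel (\<lambda>z. indicator {0<..<T} (fst z) *\<^sub>R ?g (snd z))"
    by (simp only: lborel_prod)
  then have "integrable lebesgue (\<lambda>z. indicator {0<..<T} (fst z) *\<^sub>R ?g (snd z))"
    by (subst integrable_completion) (use borel_measurable_integrable in blast)+
  moreover have "indicator {0<..<T} (fst z) = (indicator ?S z :: real)" for z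
    by (auto simp: indicator_def mem_Times_iff)
  ultimately show "integrable (lebesgue_on ?S) (\<lambda>z. ?g (snd z))"
    using strip_in_sets_lebesgue[of 0 T] by (subst integrable_restrict_space) auto
  have "(\<lambda>z::real \<times> (real^2). indicator (- cball 0 1) (snd z) *\<^sub>R ?V (snd z)) \<in> borel_measurable (borel \<Otimes>\<^sub>M borel)"
    by measurable
  then show "(\<lambda>z. indicator (- cball 0 1) (snd z) *\<^sub>R ?V (snd z)) \<in> borel_measurable (lebesgue_on ?S)"
    by (intro measurable_restrict_space1 measurable_completion) (simp add: borel_prod)
  show "integrable (lebesgue_on {0<..<T}) (\<lambda>_. 1::real)"
    using fin by (subst integrable_restrict_space) (auto simp: integrable_indicator_iff integrable_completion)
  show "AE z in lebesgue_on ?S. norm (indicator (- cball 0 1) (snd z) *\<^sub>R ?V (snd z)) \<le> 1"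
    by (rule AE_I2) (rule vfield_weighted_bound)
  show "AE z in lebesgue_on ?S. ?V (snd z) = ?g (snd z) + indicator (- cball 0 1) (snd z) *\<^sub>R ?V (snd z)"
    by (rule AE_I2) (simp add: indicator_def)
qed

text \<open>The flows disagree at every point that has crossed the origin before time
  \<open>T\<close> and does not lie on the first axis. Such points fill a nonempty open set, which
  cannot be negligible.\<close>

lemma different_flows_reflected:
  assumes T: "T > 0" shows "different_flows 0 T (flow 1) (flow (-1))"
  unfolding different_flows_def
proof (intro bexI notI)
  assume ae: "AE x in lebesgue. flow 1 T x = flow (-1) T x"
  define W where "W = {x::real^2. norm x ^ 3 + 2 * T * x$1 < 0} \<inter> {x. x$2 > 0}"
  have "open W" unfolding W_def by (intro open_Int open_Collect_less continuous_intros)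
  moreover have "W \<noteq> {}"
  proof -
    \<comment> \<open>A point on the diagonal, close enough to the origin to have crossed:
      \<open>d * d * 16 = T\<close> makes \<open>(2 * d) ^ 3\<close> equal to
      \<open>T * d / 2\<close>, below the required \<open>2 * T * d\<close>.\<close>
    define d where "d = sqrt T / 4"
    have d: "d > 0" "d * d * 16 = T" using T by (simp_all add: d_def)
    define x :: "real^2" where "x = d *\<^sub>R (axis 2 1 - axis 1 1)"
    have x: "x$1 = - d" "x$2 = d" by (simp_all add: x_def axis_def)
    have "norm x \<le> \<bar>d\<bar> * (norm (axis 2 1 :: real^2) + norm (axis 1 1 :: real^2))"
      unfolding x_def norm_scaleR by (intro mult_left_mono norm_triangle_ineq4) simp
    then have "norm x \<le> 2 * d" using d by (simp add: norm_axis_1)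
    then have "norm x ^ 3 \<le> (2 * d) ^ 3" by (intro power_mono) auto
    also have "\<dots> = T * d / 2" using d(2) by (simp add: power3_eq_cube)
    also have "\<dots> < 2 * T * d" using T d by simp
    finally have "x \<in> W" using x d by (simp add: W_def)
    then show ?thesis by blast
  qed
  ultimately have "\<not> negligible W" by (rule open_not_negligible)
  moreover have "negligible W"
  proof -
    have "negligible {x. flow 1 T x \<noteq> flow (-1) T x}"
      using ae by (auto simp: negligible_iff_null_sets completion.AE_iff_null_sets eventually_ae_filter intro: completion.complete2)
    moreover have "W \<subseteq> {x. flow 1 T x \<noteq> flow (-1) T x}"
    proof
      fix x assume x: "x \<in> W"
      then have x0: "norm x > 0" using T by (auto simp: W_def)
      then have "norm x ^ 3 * sq_factor T x = norm x ^ 3 + 2 * T * x$1"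
        by (simp add: sq_factor_def distrib_left)
      then have "norm x ^ 3 * sq_factor T x < 0" using x by (simp add: W_def)
      then have "sq_factor T x < 0" using x0 by (simp add: mult_less_0_iff)
      then have "sqrt (sq_factor T x) < 0" by simp
      then have "flow 1 T x $ 2 \<noteq> flow (-1) T x $ 2"
        using x by (simp add: flow_nth bend_eq W_def)
      then show "x \<in> {x. flow 1 T x \<noteq> flow (-1) T x}" by auto
    qed
    ultimately show ?thesis by (rule negligible_subset)
  qed
  ultimately show False by simp
qed (use T in auto)

section \<open>The equation in the sense of distributions\<close>

lemma integral_strip:
  fixes f :: "real \<times> (real^2) \<Rightarrow> real"
  assumes f: "f \<in> borel_measurable borel" and f0: "\<And>z. fst z \<notin> {0<..<T} \<Longrightarrow> f z = 0"
  shows "(\<integral>z. f z \<partial>lebesgue_on ({0<..<T} \<times> UNIV)) = (\<integral>z. f z \<partial>(lborel \<Otimes>\<^sub>M lborel))"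
proof -
  have "(\<integral>z. f z \<partial>lebesgue_on ({0<..<T} \<times> UNIV)) = (\<integral>z. indicator ({0<..<T} \<times> UNIV) z *\<^sub>R f z \<partial>lebesgue)"
    using strip_in_sets_lebesgue[of 0 T] by (intro integral_restrict_space) simp
  also have "(\<lambda>z. indicator ({0<..<T} \<times> UNIV) z *\<^sub>R f z) = f"
  proof
    fix z
    show "indicator ({0<..<T} \<times> UNIV) z *\<^sub>R f z = f z"
      using f0[of z] by (cases "fst z \<in> {0<..<T}") (simp_all add: indicator_def mem_Times_iff)
  qed
  also have "(\<integral>z. f z \<partial>lebesgue) = (\<integral>z. f z \<partial>lborel)"
    by (rule integral_completion) (use f in simp)
  finally show ?thesis by (simp only: lborel_prod)
qed

context
  fixes \<kappa> T :: real and h :: "real^2 \<Rightarrow> real" and Dh :: "real^2 \<Rightarrow> real^2" and \<phi> :: "real \<times> (real^2) \<Rightarrow> real"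
  assumes \<kappa>: "\<bar>\<kappa>\<bar> = 1"
    and Dh: "\<And>z. GDERIV h z :> Dh z" and cont_Dh: "continuous_on UNIV Dh"
    and growth: "\<exists>C. \<forall>z. \<bar>h z\<bar> \<le> C * (1 + ln (1 + norm z)) \<and> norm (Dh z) \<le> C / (1 + norm z)"
    and test: "test_function ({0<..<T} \<times> UNIV) \<phi>"
begin

interpretation test_fun "{0<..<T} \<times> UNIV" \<phi> by (standard, rule test)

definition dt_term :: "real \<times> (real^2) \<Rightarrow> real" where
  "dt_term z = h (flow \<kappa> (fst z) (snd z)) * frechet_derivative \<phi> (at z) (1, 0)"

definition transport_term :: "real \<times> (real^2) \<Rightarrow> real" where
  "transport_term z = (Dh (flow \<kappa> (fst z) (snd z)) \<bullet> vfield (flow \<kappa> (fst z) (snd z))) * \<phi> z"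

lemma h_cont: "continuous_on UNIV h"
  using Dh by (intro continuous_at_imp_continuous_on) (auto simp: gderiv_def intro: has_derivative_continuous)

lemma h_measurable: "h \<in> borel_measurable borel"
  by (rule borel_measurable_continuous_onI[OF h_cont])

lemma Dh_measurable: "Dh \<in> borel_measurable borel"
  by (rule borel_measurable_continuous_onI[OF cont_Dh])

lemma measurable_terms [measurable]:
  "dt_term \<in> borel_measurable borel" "transport_term \<in> borel_measurable borel"
proof -
  note [measurable] = h_measurable Dh_measurable
  show "dt_term \<in> borel_measurable borel" "transport_term \<in> borel_measurable borel"
    unfolding dt_term_def transport_term_def by measurable
qed

lemma terms_outside_strip:
  assumes "fst z \<notin> {0<..<T}" shows "dt_term z = 0" "transport_term z = 0"
proof -
  have z: "z \<notin> closure {z. \<phi> z \<noteq> 0}" using test assms by (auto simp: test_function_def)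
  then have "\<phi> z = 0" using closure_subset[of "{z. \<phi> z \<noteq> 0}"] by blast
  then show "transport_term z = 0" by (simp add: transport_term_def)
  show "dt_term z = 0" by (simp add: dt_term_def frechet_derivative_eq_0_outside[OF z])
qed

lemma integrable_dt_term: "integrable (lborel \<Otimes>\<^sub>M lborel) dt_term"
proof -
  obtain r where r: "r > 0" "\<And>z e. norm z \<ge> r \<Longrightarrow> frechet_derivative \<phi> (at z) e = 0"
    using support_bounded by metis
  obtain M where M: "M > 0" "\<And>z. \<bar>frechet_derivative \<phi> (at z) (1, 0)\<bar> \<le> M"
    using partial_bounded by metis
  have "bounded (h ` cball 0 (1 + r + r\<^sup>2))"
    by (intro compact_imp_bounded compact_continuous_image continuous_on_subset[OF h_cont]) auto
  then obtain K where "\<forall>y\<in>h ` cball 0 (1 + r + r\<^sup>2). norm y \<le> K" unfolding bounded_iff ..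
  then have K: "\<bar>h y\<bar> \<le> K" if "norm y \<le> 1 + r + r\<^sup>2" for y using that by auto
  have K0: "K \<ge> 0" using K[of 0] r by (auto simp: add_pos_nonneg)
  have "integrable lborel dt_term"
  proof (rule Bochner_Integration.integrable_bound[where f = "\<lambda>z. (K * M) * indicator (cball 0 r) z"])
    show "integrable lborel (\<lambda>z::real \<times> (real^2). K * M * indicator (cball 0 r) z)"
      using emeasure_lborel_cball_finite[of "0::real \<times> (real^2)" r]
      by (intro integrable_mult_right) (simp add: integrable_indicator_iff)
    show "AE z in lborel. norm (dt_term z) \<le> norm (K * M * indicator (cball 0 r) z)"
    proof (rule AE_I2)
      fix z :: "real \<times> (real^2)"
      show "norm (dt_term z) \<le> norm (K * M * indicator (cball 0 r) z)"
      proof (cases "norm z \<le> r")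
        case True
        have "\<bar>fst z\<bar> \<le> r" "norm (snd z) \<le> r"
          using True norm_fst_le[of "fst z" "snd z"] norm_snd_le[of "snd z" "fst z"] by auto
        then have "norm (flow \<kappa> (fst z) (snd z)) \<le> 1 + r + r\<^sup>2" by (rule flow_bound[OF \<kappa>])
        then have "\<bar>dt_term z\<bar> \<le> K * M"
          unfolding dt_term_def abs_mult by (intro mult_mono K M K0) auto
        then show ?thesis using True K0 M by simp
      next
        case False
        then show ?thesis by (simp add: dt_term_def r)
      qed
    qed
  qed measurable
  then show ?thesis by (simp only: lborel_prod)
qed

text \<open>The field is unbounded along trajectories that reach the origin, so no uniform bound is
  available. The term is at most a constant times 1/|X|, and at each fixed time the area estimate
  replaces the integral of 1/|X(t,x)| over \<open>x\<close> by that of 1/|y| over a ball.\<close>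

lemma integrable_transport_term: "integrable (lborel \<Otimes>\<^sub>M lborel) transport_term"
proof -
  obtain r where r: "r > 0" "\<And>z. norm z \<ge> r \<Longrightarrow> \<phi> z = 0"
    using support_bounded by metis
  obtain M where M: "M > 0" "\<And>z. \<bar>\<phi> z\<bar> \<le> M" using bounded by metis
  obtain C where C: "\<And>z. norm (Dh z) \<le> C / (1 + norm z)" using growth by blast
  have "0 \<le> norm (Dh 0)" by simp
  also have "\<dots> \<le> C" using C[of 0] by simp
  finally have C0: "C \<ge> 0" .
  have Dh_le: "norm (Dh z) \<le> C" for z
  proof -
    have "C / (1 + norm z) \<le> C" using C0 by (simp add: divide_le_eq mult_le_cancel_left1 add_pos_nonneg)
    then show ?thesis using C[of z] by linarith
  qed
  let ?R = "1 + r + r\<^sup>2"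
  \<comment> \<open>The cutoff radius comes from \<open>flow_bound\<close>: it covers all positions
    reached from the support of \<phi>, and without it 1/|y| would not be integrable over the
    plane.\<close>
  define g where "g = (\<lambda>y::real^2. ennreal (1 / norm y) * indicator (cball 0 ?R) y)"
  have [measurable]: "g \<in> borel_measurable borel" unfolding g_def by measurable
  define G where "G = (\<integral>\<^sup>+y. g y \<partial>lborel)"
  have G: "G < \<infinity>" unfolding G_def g_def by (rule nn_integral_inverse_norm_cball)
  show ?thesis
  proof (rule integrableI_bounded)
    show "transport_term \<in> borel_measurable (lborel \<Otimes>\<^sub>M lborel)"
      using measurable_terms(2) by (simp add: lborel_prod)
    have bd: "ennreal (norm (transport_term z)) \<le> ennreal (C * M) * (indicator (cball 0 r) (fst z) * g (flow \<kappa> (fst z) (snd z)))" for z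
    proof (cases "norm z \<le> r")
      case True
      have z: "\<bar>fst z\<bar> \<le> r" "norm (snd z) \<le> r"
        using True norm_fst_le[of "fst z" "snd z"] norm_snd_le[of "snd z" "fst z"] by auto
      let ?y = "flow \<kappa> (fst z) (snd z)"
      have y: "norm ?y \<le> ?R" using z by (rule flow_bound[OF \<kappa>])
      have "\<bar>Dh ?y \<bullet> vfield ?y\<bar> \<le> norm (Dh ?y) * norm (vfield ?y)" by (rule Cauchy_Schwarz_ineq2)
      also have "\<dots> \<le> C * (1 / norm ?y)" by (intro mult_mono Dh_le norm_vfield_le C0) auto
      finally have "\<bar>transport_term z\<bar> \<le> C * (1 / norm ?y) * M"
        unfolding transport_term_def abs_mult by (intro mult_mono M) (use C0 in auto)
      then have "ennreal (norm (transport_term z)) \<le> ennreal ((C * M) * (1 / norm ?y))"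
        by (intro ennreal_leI) (simp add: mult.commute mult.left_commute)
      also have "\<dots> = ennreal (C * M) * ennreal (1 / norm ?y)"
        by (rule ennreal_mult) (use C0 M in auto)
      finally show ?thesis using z y by (simp add: g_def)
    next
      case False
      then show ?thesis by (simp add: transport_term_def r)
    qed
    have "(\<integral>\<^sup>+z. ennreal (norm (transport_term z)) \<partial>(lborel \<Otimes>\<^sub>M lborel))
        \<le> (\<integral>\<^sup>+z. ennreal (C * M) * (indicator (cball 0 r) (fst z) * g (flow \<kappa> (fst z) (snd z))) \<partial>(lborel \<Otimes>\<^sub>M lborel))"
      by (intro nn_integral_mono bd)
    also have "\<dots> = (\<integral>\<^sup>+t. \<integral>\<^sup>+x. ennreal (C * M) * (indicator (cball 0 r) t * g (flow \<kappa> t x)) \<partial>lborel \<partial>lborel)"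
    proof -
      have "(\<lambda>z. ennreal (C * M) * (indicator (cball 0 r) (fst z) * g (flow \<kappa> (fst z) (snd z))))
          \<in> borel_measurable (borel \<Otimes>\<^sub>M borel)"
        by measurable
      moreover have "sets (lborel \<Otimes>\<^sub>M lborel) = sets (borel \<Otimes>\<^sub>M borel :: (real \<times> (real^2)) measure)"
        by (intro sets_pair_measure_cong) auto
      ultimately show ?thesis
        by (subst lborel.nn_integral_fst[symmetric]) (simp_all cong: measurable_cong_sets)
    qed
    also have "\<dots> = (\<integral>\<^sup>+t. ennreal (C * M) * (indicator (cball 0 r) t * (\<integral>\<^sup>+x. g (flow \<kappa> t x) \<partial>lborel)) \<partial>lborel)"
      by (simp add: nn_integral_cmult)
    also have "\<dots> \<le> (\<integral>\<^sup>+t. (ennreal (C * M) * G) * indicator (cball 0 r) (t::real) \<partial>lborel)"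
    proof (rule nn_integral_mono)
      fix t :: real
      have "(\<integral>\<^sup>+x. g (flow \<kappa> t x) \<partial>lborel) \<le> G"
        unfolding G_def by (rule nn_integral_flow_le[OF \<kappa>]) measurable
      then show "ennreal (C * M) * (indicator (cball 0 r) t * (\<integral>\<^sup>+x. g (flow \<kappa> t x) \<partial>lborel))
          \<le> (ennreal (C * M) * G) * indicator (cball 0 r) t"
        by (auto simp: indicator_def intro: mult_left_mono)
    qed
    also have "\<dots> = (ennreal (C * M) * G) * emeasure lborel (cball (0::real) r)"
      by (rule nn_integral_cmult_indicator) simp
    also have "\<dots> < \<infinity>"
      using G emeasure_lborel_cball_finite[of "0::real" r] by (auto simp: ennreal_mult_less_top)
    finally show "(\<integral>\<^sup>+z. ennreal (norm (transport_term z)) \<partial>(lborel \<Otimes>\<^sub>M lborel)) < \<infinity>" .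
  qed
qed

lemma finite_hitting_times: "finite {t. sq_factor t x = 0}"
proof -
  have "sq_factor t x = 0 \<Longrightarrow> t = - 1 / (2 * x$1 / norm x ^ 3)" for t
  proof -
    assume "sq_factor t x = 0"
    moreover have "t * (2 * x$1 / norm x ^ 3) = sq_factor t x - 1" by (simp add: sq_factor_def)
    ultimately have *: "t * (2 * x$1 / norm x ^ 3) = - 1" by simp
    have "t = - 1 / k" if "t * k = - 1" for k :: real
    proof -
      have "k \<noteq> 0" using that by auto
      from nonzero_eq_divide_eq[OF this] that show ?thesis by blast
    qed
    then show ?thesis using * by blast
  qed
  then have "{t. sq_factor t x = 0} \<subseteq> {- 1 / (2 * x$1 / norm x ^ 3)}" by blast
  then show ?thesis using finite_subset by blast
qed

text \<open>The integrand is the time derivative of h(X) \<phi> along one trajectory. It may be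
  unbounded at the crossing, but h(X) \<phi> is continuous there, and the fundamental theorem for
  the gauge integral allows finitely many exceptional times. The assumption \<open>int\<close> then
  identifies the gauge integral with the Lebesgue integral.\<close>

lemma time_section_integral:
  assumes x: "x \<noteq> 0" and int: "integrable lborel (\<lambda>t. dt_term (t, x) + transport_term (t, x))"
  shows "(\<integral>t. dt_term (t, x) + transport_term (t, x) \<partial>lborel) = 0"
proof -
  obtain r where r: "r > 0" "\<And>z. norm z \<ge> r \<Longrightarrow> \<phi> z = 0"
    "\<And>z e. norm z \<ge> r \<Longrightarrow> frechet_derivative \<phi> (at z) e = 0"
    using support_bounded by metis
  have out: "norm (t, x) \<ge> r" if "\<bar>t\<bar> \<ge> r" for t
    using that norm_fst_le[of t x] by simp
  let ?u = "\<lambda>t. h (flow \<kappa> t x) * \<phi> (t, x)"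
  let ?u' = "\<lambda>t. dt_term (t, x) + transport_term (t, x)"
  have "(?u' has_integral (?u r - ?u (- r))) {- r..r}"
  proof (rule fundamental_theorem_of_calculus_interior_strong)
    show "finite {t. sq_factor t x = 0}" by (rule finite_hitting_times)
    show "continuous_on {- r..r} ?u"
      by (intro continuous_on_mult continuous_on_compose2[OF h_cont continuous_flow_time]
          continuous_on_compose2[OF continuous[of UNIV]] continuous_intros) auto
    fix t assume "t \<in> {- r<..<r} - {t. sq_factor t x = 0}"
    then have q: "sq_factor t x \<noteq> 0" by simp
    let ?y = "flow \<kappa> t x"
    have "(h has_derivative (\<lambda>k. k \<bullet> Dh ?y)) (at ?y)" using Dh by (simp add: gderiv_def)
    from has_derivative_compose[OF flow_has_vector_derivative[OF \<kappa> x q, unfolded has_vector_derivative_def] this]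
    have d1: "((\<lambda>t. h (flow \<kappa> t x)) has_derivative (\<lambda>s. s * (vfield ?y \<bullet> Dh ?y))) (at t)"
      by (simp only: inner_scaleR_left)
    have "((\<lambda>t. (t, x)) has_derivative (\<lambda>s. (s, 0))) (at t)"
      by (intro has_derivative_Pair has_derivative_ident has_derivative_const)
    from has_derivative_compose[OF this derivative]
    have d2: "((\<lambda>t. \<phi> (t, x)) has_derivative (\<lambda>s. frechet_derivative \<phi> (at (t, x)) (s, 0))) (at t)" .
    have lin: "frechet_derivative \<phi> (at (t, x)) (s, 0) = s * frechet_derivative \<phi> (at (t, x)) (1, 0)" for s
    proof -
      interpret bounded_linear "frechet_derivative \<phi> (at (t, x))"
        by (rule has_derivative_bounded_linear[OF derivative])
      show ?thesis using scaleR[of s "(1, 0)"] by simp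
    qed
    have "(?u has_derivative (\<lambda>s. h ?y * frechet_derivative \<phi> (at (t, x)) (s, 0)
        + s * (vfield ?y \<bullet> Dh ?y) * \<phi> (t, x))) (at t)"
      by (rule has_derivative_mult[OF d1 d2])
    moreover have "h ?y * frechet_derivative \<phi> (at (t, x)) (s, 0) + s * (vfield ?y \<bullet> Dh ?y) * \<phi> (t, x)
        = s *\<^sub>R ?u' t" for s
      unfolding lin[of s] dt_term_def transport_term_def
      by (simp add: inner_commute[of "vfield ?y"] distrib_left)
    ultimately show "(?u has_vector_derivative ?u' t) (at t)"
      unfolding has_vector_derivative_def by (simp only:)
  qed (use r in simp)
  then have "(?u' has_integral 0) {- r..r}" using out[of r] out[of "- r"] r by simp
  then have "(?u' has_integral 0) UNIV"
  proof (rule has_integral_on_superset)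
    fix t assume "t \<notin> {- r..r}"
    then have "norm (t, x) \<ge> r" by (intro out) auto
    then show "?u' t = 0" by (simp add: dt_term_def transport_term_def r)
  qed simp
  with has_integral_integral_lborel[OF int] show ?thesis by (rule has_integral_unique)
qed

text \<open>Fubini with time as the inner variable: the sum of both terms integrates to zero along
  every trajectory not starting at the origin. Each term is integrable on its own, so the vanishing
  total can be split into the two sides of the equation.\<close>

lemma flow_weak_equation:
  "- (\<integral>z. h (flow \<kappa> (fst z) (snd z)) * frechet_derivative \<phi> (at z) (1, 0) \<partial>lebesgue_on ({0<..<T} \<times> UNIV))
   = (\<integral>z. (Dh (flow \<kappa> (fst z) (snd z)) \<bullet> vfield (flow \<kappa> (fst z) (snd z))) * \<phi> z \<partial>lebesgue_on ({0<..<T} \<times> UNIV))"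
proof -
  let ?f = "\<lambda>t x. dt_term (t, x) + transport_term (t, x)"
  have "integrable (lborel \<Otimes>\<^sub>M lborel) (\<lambda>z. dt_term z + transport_term z)"
    by (intro Bochner_Integration.integrable_add integrable_dt_term integrable_transport_term)
  moreover have f: "case_prod ?f = (\<lambda>z. dt_term z + transport_term z)" by (simp add: fun_eq_iff)
  ultimately have int: "integrable (lborel \<Otimes>\<^sub>M lborel) (case_prod ?f)" by (simp only:)
  have "AE x in lborel. (\<integral>t. ?f t x \<partial>lborel) = 0"
    using lborel_pair.AE_integrable_snd[OF int] AE_lborel_singleton[of "0::real^2"]
    by eventually_elim (rule time_section_integral)
  then have "(\<integral>x. (\<integral>t. ?f t x \<partial>lborel) \<partial>lborel) = 0" by (rule integral_eq_zero_AE)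
  then have "(\<integral>z. dt_term z + transport_term z \<partial>(lborel \<Otimes>\<^sub>M lborel)) = 0"
    using lborel_pair.integral_snd[OF int] unfolding f by (simp only:)
  then have "- (\<integral>z. dt_term z \<partial>(lborel \<Otimes>\<^sub>M lborel)) = (\<integral>z. transport_term z \<partial>(lborel \<Otimes>\<^sub>M lborel))"
    using Bochner_Integration.integral_add[OF integrable_dt_term integrable_transport_term] by simp
  note eq = this
  have "- (\<integral>z. dt_term z \<partial>lebesgue_on ({0<..<T} \<times> UNIV)) = (\<integral>z. transport_term z \<partial>lebesgue_on ({0<..<T} \<times> UNIV))"
  proof -
    have "(\<integral>z. dt_term z \<partial>lebesgue_on ({0<..<T} \<times> UNIV)) = (\<integral>z. dt_term z \<partial>(lborel \<Otimes>\<^sub>M lborel))"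
      by (rule integral_strip[OF measurable_terms(1)]) (rule terms_outside_strip)
    moreover have "(\<integral>z. transport_term z \<partial>lebesgue_on ({0<..<T} \<times> UNIV)) = (\<integral>z. transport_term z \<partial>(lborel \<Otimes>\<^sub>M lborel))"
      by (rule integral_strip[OF measurable_terms(2)]) (rule terms_outside_strip)
    ultimately show ?thesis using eq by (simp only:)
  qed
  then show ?thesis by (simp add: dt_term_def transport_term_def)
qed

end

section \<open>Two regular Lagrangian flows of one field\<close>

lemma regular_Lagrangian_flow_vfield:
  assumes \<kappa>: "\<bar>\<kappa>\<bar> = 1" and T: "T > 0"
  shows "regular_Lagrangian_flow 0 T (\<lambda>t. vfield) (flow \<kappa>)"
  unfolding regular_Lagrangian_flow_def
proof (intro conjI allI impI)
  show "R1 T (\<lambda>t. vfield)" by (rule R1_vfield)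
  show "continuous_L0_loc 0 T (flow \<kappa>)" by (rule continuous_L0_loc_flow)
  show "bounded_logL_loc 0 T (flow \<kappa>)" by (rule bounded_logL_loc_flow[OF \<kappa>])
  show "(\<lambda>z. flow \<kappa> (fst z) (snd z)) \<in> borel_measurable (lebesgue_on ({0..T} \<times> UNIV))"
    by (intro measurable_restrict_space1 measurable_completion) simp
  show "AE x in lebesgue. flow \<kappa> 0 x = x" by (simp add: flow_0)
  show "\<exists>L>0. \<forall>f. f \<in> borel_measurable lebesgue \<and> (\<forall>x. 0 \<le> f x) \<longrightarrow>
      (\<forall>t\<in>{0..T}. (\<integral>\<^sup>+x. ennreal (f (flow \<kappa> t x)) \<partial>lebesgue) \<le> ennreal L * (\<integral>\<^sup>+x. ennreal (f x) \<partial>lebesgue))"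
    by (rule exI[of _ 1]) (simp add: flow_compressible[OF \<kappa>])
  fix h :: "real^2 \<Rightarrow> real" and Dh :: "real^2 \<Rightarrow> real^2" and \<phi> :: "real \<times> (real^2) \<Rightarrow> real"
  assume h: "(\<forall>z. GDERIV h z :> Dh z) \<and> continuous_on UNIV Dh \<and>
      (\<exists>C. \<forall>z. \<bar>h z\<bar> \<le> C * (1 + ln (1 + norm z)) \<and> norm (Dh z) \<le> C / (1 + norm z))"
    and \<phi>: "test_function ({0<..<T} \<times> UNIV) \<phi>"
  show "- (\<integral>z. h (flow \<kappa> (fst z) (snd z)) * frechet_derivative \<phi> (at z) (1, 0) \<partial>lebesgue_on ({0<..<T} \<times> UNIV))
    = (\<integral>z. (Dh (flow \<kappa> (fst z) (snd z)) \<bullet> vfield (flow \<kappa> (fst z) (snd z))) * \<phi> z \<partial>lebesgue_on ({0<..<T} \<times> UNIV))"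
    by (rule flow_weak_equation[OF \<kappa> _ _ _ \<phi>]) (use h in blast)+
qed (use T in auto)

theorem proposition1:
  shows "\<exists>(m::nat) (B :: real^2 \<Rightarrow> real^2) (\<Omega> :: 2 \<Rightarrow> nat \<Rightarrow> real^2 \<Rightarrow> real).
    m \<ge> 2 \<and>
    (\<forall>i. \<forall>j\<in>{1..m}. zero_homogeneous (\<Omega> i j) \<and> in_Linf_S1 (\<Omega> i j) \<and> in_BV_S1 (\<Omega> i j) \<and>
        mean_zero_S1 (\<Omega> i j)) \<and>
    B \<in> borel_measurable lebesgue \<and>
    in_L1_plus_Linf (\<lambda>x. norm (B x) / (norm x + 1)) \<and>
    weakly_div_free B \<and>
    (\<forall>R>1. \<exists>\<mu> :: 2 \<Rightarrow> nat \<Rightarrow> (real^2) signed_measure.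
        (\<forall>l. \<forall>j\<in>{1..m}. bounded_Radon (\<mu> l j)) \<and>
        (\<forall>i l. weak_partial_eq_pv_conv (ball 0 R) l (\<lambda>x. B x $ i) m (\<Omega> i) (\<mu> l))) \<and>
    (\<forall>T>0. \<exists>X1 X2.
        regular_Lagrangian_flow 0 T (\<lambda>t. B) X1 \<and>
        regular_Lagrangian_flow 0 T (\<lambda>t. B) X2 \<and>
        different_flows 0 T X1 X2)"
proof (intro exI[of _ "2::nat"] exI[of _ vfield] exI[of _ "\<lambda>i j. omega i (of_nat j)"] conjI allI ballI impI)
  show "vfield \<in> borel_measurable lebesgue" by (rule measurable_completion) measurable
  show "in_L1_plus_Linf (\<lambda>x. norm (vfield x) / (norm x + 1))" by (rule in_L1_plus_Linf_vfield)
  show "weakly_div_free vfield" by (rule weakly_div_free_vfield)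
  show "\<exists>\<mu>. (\<forall>l. \<forall>j\<in>{1..2}. bounded_Radon (\<mu> l j)) \<and>
      (\<forall>i l. weak_partial_eq_pv_conv (ball 0 R) l (\<lambda>x. vfield x $ i) 2 (\<lambda>j. omega i (of_nat j)) (\<mu> l))" for R
    by (rule exI[of _ dirac_at_index]) (simp add: bounded_Radon_dirac weak_partial_vfield)
  show "\<exists>X1 X2. regular_Lagrangian_flow 0 T (\<lambda>t. vfield) X1 \<and>
      regular_Lagrangian_flow 0 T (\<lambda>t. vfield) X2 \<and> different_flows 0 T X1 X2" if "T > 0" for T
    by (rule exI[of _ "flow 1"], rule exI[of _ "flow (-1)"])
      (simp add: that regular_Lagrangian_flow_vfield different_flows_reflected)
qed (simp_all add: zero_homogeneous_omega in_Linf_omega in_BV_omega mean_zero_omega)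

end
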